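(* For every integer $m\ge0$ there is an isomorphism of representations of $Sp(2\infty)$ $$W_{2m}\simeq M_{\infty-m}.$$
   Context: Fermionic Fock space: let $\tilde\psi_{2n},\tilde\psi_{2n}^*$ ($n\in\mathbb Z$) satisfy $[\tilde\psi_{2k},\tilde\psi_{2l}]_+=[\tilde\psi^*_{2k},\tilde\psi^*_{2l}]_+=0$, $[\tilde\psi_{2k},\tilde\psi^*_{2l}]_+=\delta_{k,l}$, and let $|0\rangle$ be the vacuum with $\tilde\psi_{2n}|0\rangle=0$ for $n>0$ and $\tilde\psi^*_{2n}|0\rangle=0$ for $n\le0$. For $m\in\mathbb Z$, $\tilde H_{2m}$ is the complex vector space with basis $\tilde\psi_{2r_1}\cdots\tilde\psi_{2r_k}\tilde\psi^*_{2s_1}\cdots\tilde\psi^*_{2s_{k+m}}|0\rangle$, $r_1<\dots<r_k\le0<s_1<\dots<s_{k+m}$ ($k\ge\max(0,-m)$). Vacua $|2m\rangle\in\tilde H_{2m}$ are normalized by $\tilde\psi^*_{2m}|2m-2\rangle=|2m\rangle$. Put, for $n\ge1$, $$\alpha_n=\tilde\psi^*_{-2(n-1)},\quad\beta_n=\tilde\psi^*_{2n},\quad\alpha_n^*=\tilde\psi_{-2(n-1)},\quad\beta_n^*=\tilde\psi_{2n},\qquad \omega=-\sum_{n\ge1}\alpha_n^*\beta_n^*.$$ Then $\omega:\tilde H_{2m+4}\to\tilde H_{2m}$ and $W_{2m}=\tilde H_{2m}/\omega\tilde H_{2m+4}$. Symplectic group: $V_N=\bigoplus_{i=1}^N\mathbb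 C\alpha_i\oplus\bigoplus_{i=1}^N\mathbb C\beta_i$, $\eta_N=\sum_{i=1}^N\alpha_i\wedge\beta_i$; $Sp(2N)$ is the group of linear automorphisms of $V_N$ preserving $\eta_N$. For $N<N'$, $Sp(2N)\subset Sp(2N')$ by acting trivially on $\alpha_i,\beta_i$ with $N<i\le N'$, and $Sp(2\infty)=\varinjlim Sp(2N)$. Modules: $M_k^{(N)}=\wedge^kV_N/(\eta_N\wedge\wedge^{k-2}V_N)$ (with $\wedge^{j}V_N=0$ for $j<0$). For $m\le N<N'$ the map $\wedge^{N-m}V_N\to\wedge^{N'-m}V_{N'}$, $v\mapsto v\wedge\alpha_{N+1}\wedge\cdots\wedge\alpha_{N'}$, induces $M^{(N)}_{N-m}\to M^{(N')}_{N'-m}$, and $M_{\infty-m}=\varinjlim_N M_{N-m}^{(N)}$, with the induced action of $Sp(2\infty)$. Action on $W_{2m}$: $g\in Sp(2N)$ acts on $\bigoplus_m\tilde H_{2m}$ by $g(v_1\cdots v_k\,y\,|-2N\rangle)=(gv_1)\cdots(gv_k)\,y\,|-2N\rangle$ for $v_1,\dots,v_k\in V_N$ (linear combinations of the operators $\alpha_i,\beta_i$, $i\le N$) and $y$ a product of operators $\alpha_n,\beta_n,\alpha_n^*,\beta_n^*$ with $n>N$. These actions are compatible for varying $N$, preserve each $\tilde H_{2m}$ and commute with $\omega$, so $Sp(2\infty)$ acts on $W_{2m}$. *)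

theory Defs
  imports
    Complex_Main
    "HOL-Library.Poly_Mapping"
    "HOL-Algebra.Module"
    "HOL-Algebra.AbelCoset"
begin

section \<open>Free complex vector spaces\<close>

text \<open>The type \<open>'a \<Rightarrow>\<^sub>0 complex\<close> is the complex vector space with basis \<open>bas a\<close>.\<close>

abbreviation "lookup \<equiv> Poly_Mapping.lookup"
abbreviation "keys \<equiv> Poly_Mapping.keys"

definition cscale :: "complex \<Rightarrow> ('a \<Rightarrow>\<^sub>0 complex) \<Rightarrow> ('a \<Rightarrow>\<^sub>0 complex)" (infixr \<open>*\<^sub>C\<close> 75)
  where "c *\<^sub>C x = Poly_Mapping.map ((*) c) x"

definition bas :: "'a \<Rightarrow> ('a \<Rightarrow>\<^sub>0 complex)"
  where "bas a = Poly_Mapping.single a 1"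

lemma lookup_cscale [simp]: "lookup (c *\<^sub>C x) a = c * lookup x a"
  by (simp add: cscale_def map.rep_eq when_def)

global_interpretation pm: vector_space "cscale :: complex \<Rightarrow> ('a \<Rightarrow>\<^sub>0 complex) \<Rightarrow> _"
  by unfold_locales (auto intro!: poly_mapping_eqI simp: lookup_add algebra_simps)

text \<open>\<open>linext f\<close> is the linear map with \<open>bas a \<mapsto> f a\<close>.\<close>

definition linext :: "('a \<Rightarrow> ('b \<Rightarrow>\<^sub>0 complex)) \<Rightarrow> ('a \<Rightarrow>\<^sub>0 complex) \<Rightarrow> ('b \<Rightarrow>\<^sub>0 complex)"
  where "linext f x = (\<Sum>a\<in>keys x. lookup x a *\<^sub>C f a)"

lemma linext_superset:
  assumes "finite A" "keys x \<subseteq> A"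
  shows "linext f x = (\<Sum>a\<in>A. lookup x a *\<^sub>C f a)"
  unfolding linext_def using assms
  by (intro sum.mono_neutral_left) (auto simp: in_keys_iff)

lemma linext_add: "linext f (x + y) = linext f x + linext f y"
proof -
  let ?A = "keys x \<union> keys y"
  have "keys (x + y) \<subseteq> ?A" by (rule Poly_Mapping.keys_add)
  then show ?thesis
    by (subst (1 2 3) linext_superset[of ?A])
      (auto simp: lookup_add pm.scale_left_distrib sum.distrib)
qed

lemma linext_scale: "linext f (c *\<^sub>C x) = c *\<^sub>C linext f x"
proof -
  have "keys (c *\<^sub>C x) \<subseteq> keys x" by (auto simp: in_keys_iff)
  then show ?thesis
    by (subst linext_superset[of "keys x"])
      (auto simp: linext_def pm.scale_sum_right)
qed

lemma linear_linext: "Vector_Spaces.linear cscale cscale (linext f)"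
  unfolding Vector_Spaces.linear_iff
  by (auto simp: linext_add linext_scale pm.vector_space_axioms)

lemma linext_bas [simp]: "linext f (bas a) = f a"
  by (simp add: linext_def bas_def)

lemma linext_bas_id [simp]: "linext bas x = x"
proof (rule poly_mapping_eqI)
  fix k
  have "lookup (linext bas x) k = (\<Sum>a\<in>keys x. lookup x a * (1 when a = k))"
    by (simp add: linext_def lookup_sum bas_def lookup_single)
  also have "\<dots> = lookup x k"
    by (simp add: when_def in_keys_iff if_distrib[of "(*) _"] cong: if_cong)
  finally show "lookup (linext bas x) k = lookup x k" .
qed


section \<open>Wedge monomials indexed by sets of integers\<close>

text \<open>
  For \<open>S :: int set\<close> bounded above, \<open>bas S\<close> stands for \<open>e\<^sub>s \<and> e\<^sub>t \<and> \<dots>\<close> with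
  \<open>s > t > \<dots>\<close> the elements of \<open>S\<close> in decreasing order.  Finite sets give the exterior algebra
  of \<open>V\<^sub>\<infinity> = \<Oplus>\<^sub>n \<complex> e\<^sub>n\<close>; sets that differ from \<open>{..0}\<close> in finitely many places give
  the fermionic Fock space, on which \<open>\<psi>\<^sup>*\<^sub>2\<^sub>n\<close> is left multiplication by \<open>e\<^sub>n\<close>.
\<close>

type_synonym vec = "int \<Rightarrow>\<^sub>0 complex"
type_synonym ext = "int set \<Rightarrow>\<^sub>0 complex"

definition wsign :: "int set \<Rightarrow> int set \<Rightarrow> complex"
  where "wsign A B = (-1) ^ card {(a, b). a \<in> A \<and> b \<in> B \<and> a < b}"

definition wedge :: "ext \<Rightarrow> ext \<Rightarrow> ext"
  where "wedge x y =
    linext (\<lambda>A. linext (\<lambda>B. if A \<inter> B = {} then wsign A B *\<^sub>C bas (A \<union> B) else 0) y) x"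

definition emb :: "vec \<Rightarrow> ext"
  where "emb = linext (\<lambda>n. bas {n})"

definition vop :: "vec \<Rightarrow> ext \<Rightarrow> ext"
  where "vop v x = wedge (emb v) x"


section \<open>Fermionic Fock space\<close>

text \<open>\<open>psi n\<close> and \<open>psis n\<close> are the operators \<open>\<psi>\<^sub>2\<^sub>n\<close> and \<open>\<psi>\<^sup>*\<^sub>2\<^sub>n\<close>
  (the index counts pairs, so the space of charge \<open>2m\<close> is \<open>fock m\<close>).\<close>

definition n_above :: "int \<Rightarrow> int set \<Rightarrow> nat"
  where "n_above n S = card {s \<in> S. n < s}"

definition psis :: "int \<Rightarrow> ext \<Rightarrow> ext"
  where "psis n =
    linext (\<lambda>S. if n \<in> S then 0 else (-1) ^ n_above n S *\<^sub>C bas (insert n S))"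

definition psi :: "int \<Rightarrow> ext \<Rightarrow> ext"
  where "psi n =
    linext (\<lambda>S. if n \<in> S then (-1) ^ n_above n S *\<^sub>C bas (S - {n}) else 0)"

definition vac :: "int \<Rightarrow> ext"
  where "vac m = bas {..m}"

definition fock_monomials :: "int \<Rightarrow> ext set"
  where "fock_monomials m =
    {foldr psi rs (foldr psis ss (vac 0)) | rs ss.
       sorted_wrt (<) rs \<and> sorted_wrt (<) ss \<and> (\<forall>r\<in>set rs. r \<le> 0) \<and> (\<forall>s\<in>set ss. 0 < s) \<and>
       int (length ss) = int (length rs) + m}"

definition fock :: "int \<Rightarrow> ext set"
  where "fock m = pm.span (fock_monomials m)"

definition alpha :: "nat \<Rightarrow> ext \<Rightarrow> ext" where "alpha n = psis (- (int n - 1))"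
definition beta :: "nat \<Rightarrow> ext \<Rightarrow> ext" where "beta n = psis (int n)"
definition alpha_star :: "nat \<Rightarrow> ext \<Rightarrow> ext" where "alpha_star n = psi (- (int n - 1))"
definition beta_star :: "nat \<Rightarrow> ext \<Rightarrow> ext" where "beta_star n = psi (int n)"

text \<open>On a vector of the Fock space only finitely many summands are nonzero.\<close>

definition omega :: "ext \<Rightarrow> ext"
  where "omega x =
    - (\<Sum>n \<in> {n. 1 \<le> n \<and> alpha_star n (beta_star n x) \<noteq> 0}. alpha_star n (beta_star n x))"


section \<open>Quotients and direct limits of vector spaces\<close>

definition subspace_mod :: "('a \<Rightarrow>\<^sub>0 complex) set \<Rightarrow> (complex, 'a \<Rightarrow>\<^sub>0 complex) module"
  where "subspace_mod A =
    \<lparr>carrier = A, monoid.mult = undefined, one = undefined, zero = 0, add = (+), smult = cscale\<rparr>"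

definition quot_mod :: "('r, 'a) module \<Rightarrow> 'a set \<Rightarrow> ('r, 'a set) module"
  where "quot_mod M U =
    \<lparr>carrier = a_rcosets\<^bsub>M\<^esub> U, monoid.mult = undefined, one = undefined,
     zero = U, add = (<+>\<^bsub>M\<^esub>), smult = (\<lambda>c X. \<Union>x\<in>X. U +>\<^bsub>M\<^esub> (c \<odot>\<^bsub>M\<^esub> x))\<rparr>"

text \<open>The map into \<open>quot_mod M U\<close> induced by \<open>f\<close>, on cosets.\<close>

definition quot_map :: "('r, 'b) module \<Rightarrow> 'b set \<Rightarrow> ('a \<Rightarrow> 'b) \<Rightarrow> 'a set \<Rightarrow> 'b set"
  where "quot_map M U f X = (\<Union>x\<in>X. U +>\<^bsub>M\<^esub> f x)"

text \<open>Direct limit of the modules \<open>M N\<close> (\<open>N \<in> I\<close>) along \<open>\<tau> N N' : M N \<rightarrow> M N'\<close> (\<open>N \<le> N'\<close>):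
  classes of pairs \<open>(N, x)\<close> with \<open>x \<in> M N\<close>, two pairs being identified if they become equal at a
  later stage.\<close>

definition dirlim_rel ::
    "nat set \<Rightarrow> (nat \<Rightarrow> ('r, 'a) module) \<Rightarrow> (nat \<Rightarrow> nat \<Rightarrow> 'a \<Rightarrow> 'a) \<Rightarrow> ((nat \<times> 'a) \<times> (nat \<times> 'a)) set"
  where "dirlim_rel I M \<tau> =
    {((N, x), (N', x')). N \<in> I \<and> x \<in> carrier (M N) \<and> N' \<in> I \<and> x' \<in> carrier (M N') \<and>
       (\<exists>K\<in>I. N \<le> K \<and> N' \<le> K \<and> \<tau> N K x = \<tau> N' K x')}"

definition dirlim ::
    "nat set \<Rightarrow> (nat \<Rightarrow> ('r, 'a) module) \<Rightarrow> (nat \<Rightarrow> nat \<Rightarrow> 'a \<Rightarrow> 'a) \<Rightarrow> ('r, (nat \<times> 'a) set) module"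
  where "dirlim I M \<tau> =
    (let R = dirlim_rel I M \<tau> in
     \<lparr>carrier = (SIGMA N:I. carrier (M N)) // R, monoid.mult = undefined, one = undefined,
      zero = (\<Union>N\<in>I. R `` {(N, \<zero>\<^bsub>M N\<^esub>)}),
      add = (\<lambda>X Y. \<Union>(N, x)\<in>X. \<Union>(N', y)\<in>Y.
               R `` {(max N N', \<tau> N (max N N') x \<oplus>\<^bsub>M (max N N')\<^esub> \<tau> N' (max N N') y)}),
      smult = (\<lambda>c X. \<Union>(N, x)\<in>X. R `` {(N, c \<odot>\<^bsub>M N\<^esub> x)})\<rparr>)"


section \<open>The symplectic groups\<close>

text \<open>As operators, \<open>\<alpha>\<^sub>n = e\<^sub>1\<^sub>-\<^sub>n\<close> and \<open>\<beta>\<^sub>n = e\<^sub>n\<close>; so \<open>V\<^sub>N\<close> has basis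
  \<open>e\<^sub>s\<close> with \<open>-N < s \<le> N\<close>.\<close>

definition alpha_vec :: "nat \<Rightarrow> vec" where "alpha_vec n = bas (- (int n - 1))"
definition beta_vec :: "nat \<Rightarrow> vec" where "beta_vec n = bas (int n)"

definition win :: "nat \<Rightarrow> int set"
  where "win N = {- int N<..int N}"

definition V :: "nat \<Rightarrow> vec set"
  where "V N = pm.span (alpha_vec ` {1..N} \<union> beta_vec ` {1..N})"

definition eta :: "nat \<Rightarrow> ext"
  where "eta N = (\<Sum>i = 1..N. wedge (emb (alpha_vec i)) (emb (beta_vec i)))"

text \<open>\<open>img_wedge g A z\<close> is \<open>g e\<^sub>a \<and> g e\<^sub>b \<and> \<dots> \<and> z\<close> where \<open>A = {a > b > \<dots>}\<close>;
  \<open>ext_map g\<close> is the map of exterior algebras induced by \<open>g\<close>.\<close>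

definition img_wedge :: "(vec \<Rightarrow> vec) \<Rightarrow> int set \<Rightarrow> ext \<Rightarrow> ext"
  where "img_wedge g A z = foldr (\<lambda>a. vop (g (bas a))) (rev (sorted_list_of_set A)) z"

definition ext_map :: "(vec \<Rightarrow> vec) \<Rightarrow> ext \<Rightarrow> ext"
  where "ext_map g = linext (\<lambda>A. img_wedge g A (bas {}))"

text \<open>An element of \<open>Sp(2N)\<close> is represented by its extension to \<open>V\<^sub>\<infinity>\<close> that fixes
  \<open>\<alpha>\<^sub>i\<close>, \<open>\<beta>\<^sub>i\<close> for \<open>i > N\<close>.  The embeddings \<open>Sp(2N) \<subset> Sp(2N')\<close> are then inclusions, and the
  direct limit is the union.\<close>

definition Sp :: "nat \<Rightarrow> (vec \<Rightarrow> vec) monoid"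
  where "Sp N =
    \<lparr>carrier = {g. Vector_Spaces.linear cscale cscale g \<and> bij_betw g (V N) (V N) \<and>
                   (\<forall>i>N. g (alpha_vec i) = alpha_vec i \<and> g (beta_vec i) = beta_vec i) \<and>
                   ext_map g (eta N) = eta N},
     monoid.mult = (\<circ>), one = id\<rparr>"

definition Sp_inf :: "(vec \<Rightarrow> vec) monoid"
  where "Sp_inf = \<lparr>carrier = (\<Union>N. carrier (Sp N)), monoid.mult = (\<circ>), one = id\<rparr>"


section \<open>The representation on the quotient of the Fock space\<close>

text \<open>With \<open>A = S \<inter> win N\<close> and \<open>B = S - win N\<close>, the basis vector \<open>bas S\<close> equals
  \<open>wsign A B\<close> times \<open>e\<^sub>a \<and> e\<^sub>b \<and> \<dots> \<and> bas B\<close> (\<open>A = {a > b > \<dots>}\<close>), and \<open>bas B\<close> is,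
  up to sign, of the form \<open>y |-2N\<rangle>\<close>.  The formula
  \<open>g (v\<^sub>1 \<dots> v\<^sub>k y |-2N\<rangle>) = (g v\<^sub>1) \<dots> (g v\<^sub>k) y |-2N\<rangle>\<close> is lemma \<open>fock_act_formula\<close> below.\<close>

definition fock_act :: "nat \<Rightarrow> (vec \<Rightarrow> vec) \<Rightarrow> ext \<Rightarrow> ext"
  where "fock_act N g =
    linext (\<lambda>S. wsign (S \<inter> win N) (S - win N) *\<^sub>C img_wedge g (S \<inter> win N) (bas (S - win N)))"

definition W :: "int \<Rightarrow> (complex, ext set) module"
  where "W m = quot_mod (subspace_mod (fock m)) (omega ` fock (m + 2))"

text \<open>The action of \<open>g\<close> does not depend on the choice of \<open>N\<close> with \<open>g \<in> Sp N\<close>.\<close>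

definition W_act :: "int \<Rightarrow> (vec \<Rightarrow> vec) \<Rightarrow> ext set \<Rightarrow> ext set"
  where "W_act m g X =
    (\<Union>N \<in> {N. g \<in> carrier (Sp N)}.
       quot_map (subspace_mod (fock m)) (omega ` fock (m + 2)) (fock_act N g) X)"


section \<open>The representation on the limit of exterior powers\<close>

definition ext_power :: "nat \<Rightarrow> int \<Rightarrow> ext set"
  where "ext_power N k = {x. \<forall>S\<in>keys x. S \<subseteq> win N \<and> int (card S) = k}"

definition eta_ideal :: "nat \<Rightarrow> int \<Rightarrow> ext set"
  where "eta_ideal N k = wedge (eta N) ` ext_power N (k - 2)"

definition M_fin :: "nat \<Rightarrow> int \<Rightarrow> (complex, ext set) module"
  where "M_fin N k = quot_mod (subspace_mod (ext_power N k)) (eta_ideal N k)"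

definition M_fin_map :: "nat \<Rightarrow> int \<Rightarrow> (ext \<Rightarrow> ext) \<Rightarrow> ext set \<Rightarrow> ext set"
  where "M_fin_map N k f = quot_map (subspace_mod (ext_power N k)) (eta_ideal N k) f"

definition wedge_alphas :: "nat \<Rightarrow> nat \<Rightarrow> ext \<Rightarrow> ext"
  where "wedge_alphas N N' v = foldl (\<lambda>x i. wedge x (emb (alpha_vec i))) v [Suc N..<Suc N']"

definition M_trans :: "nat \<Rightarrow> nat \<Rightarrow> nat \<Rightarrow> ext set \<Rightarrow> ext set"
  where "M_trans m N N' = M_fin_map N' (int N' - int m) (wedge_alphas N N')"

definition M_inf :: "nat \<Rightarrow> (complex, (nat \<times> ext set) set) module"
  where "M_inf m = dirlim {m..} (\<lambda>N. M_fin N (int N - int m)) (M_trans m)"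

text \<open>A class is acted on by \<open>g\<close> through its representatives at those levels \<open>N\<close> for which
  \<open>g \<in> Sp N\<close>.\<close>

definition M_act :: "nat \<Rightarrow> (vec \<Rightarrow> vec) \<Rightarrow> (nat \<times> ext set) set \<Rightarrow> (nat \<times> ext set) set"
  where "M_act m g X =
    (\<Union>(N, x) \<in> {(N, x) \<in> X. g \<in> carrier (Sp N)}.
       dirlim_rel {m..} (\<lambda>N. M_fin N (int N - int m)) (M_trans m) ``
         {(N, M_fin_map N (int N - int m) (ext_map g) x)})"


section \<open>Isomorphisms of representations\<close>

definition rep_iso ::
    "'g monoid \<Rightarrow> ('r, 'a) module \<Rightarrow> ('g \<Rightarrow> 'a \<Rightarrow> 'a) \<Rightarrow> ('r, 'b) module \<Rightarrow> ('g \<Rightarrow> 'b \<Rightarrow> 'b) \<Rightarrow> ('a \<Rightarrow> 'b) \<Rightarrow> bool"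
  where "rep_iso G A \<rho> B \<sigma> \<phi> \<longleftrightarrow>
    \<phi> \<in> iso (add_monoid A) (add_monoid B) \<and>
    (\<forall>c. \<forall>x\<in>carrier A. \<phi> (c \<odot>\<^bsub>A\<^esub> x) = c \<odot>\<^bsub>B\<^esub> \<phi> x) \<and>
    (\<forall>g\<in>carrier G. \<forall>x\<in>carrier A. \<phi> (\<rho> g x) = \<sigma> g (\<phi> x))"

section \<open>Properties of the model\<close>

lemmas linext_lin = linext_add linext_scale
lemma linext_zero [simp]: "linext f 0 = 0" by (simp add: linext_def)
lemma linext_uminus: "linext f (- x) = - linext f x"
  using linext_scale[of f "-1" x] by simp
lemma linext_sum: "linext f (sum h I) = (\<Sum>i\<in>I. linext f (h i))"
  by (induction I rule: infinite_finite_induct) (auto simp: linext_add)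

lemma linext_eqI: "(\<And>a. a \<in> keys x \<Longrightarrow> f a = f' a) \<Longrightarrow> linext f x = linext f' x"
  by (simp add: linext_def)

lemma linext_fun_add: "linext (\<lambda>a. f a + h a) x = linext f x + linext h x"
  by (simp add: linext_def pm.scale_right_distrib sum.distrib)
lemma linext_fun_scale: "linext (\<lambda>a. c *\<^sub>C f a) x = c *\<^sub>C linext f x"
  by (simp add: linext_def pm.scale_sum_right mult.commute)
lemma linext_fun_zero [simp]: "linext (\<lambda>a. 0) x = 0"
  by (simp add: linext_def)
lemma linext_fun_uminus: "linext (\<lambda>a. - f a) x = - linext f x"
  using linext_fun_scale[of "-1" f x] by simp
lemma linext_linext: "linext f (linext h x) = linext (\<lambda>a. linext f (h a)) x"
  unfolding linext_def[of h] linext_def[of "\<lambda>a. linext f (h a)"] by (simp add: linext_sum linext_scale)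
lemma linext_swap: "linext (\<lambda>a. linext (\<lambda>b. f a b) y) x = linext (\<lambda>b. linext (\<lambda>a. f a b) x) y"
  by (simp add: linext_def pm.scale_sum_right mult.commute, subst sum.swap, simp add: mult.commute)

text \<open>\<open>wedge\<close> is bilinear and associative, and vectors square to zero (\<open>vop_vop_self\<close>).\<close>

lemma wedge_bas: "wedge (bas A) (bas B) = (if A \<inter> B = {} then wsign A B *\<^sub>C bas (A \<union> B) else 0)"
  by (simp add: wedge_def)

lemma wedge_add_left: "wedge (x + y) z = wedge x z + wedge y z"
  and wedge_scale_left: "wedge (c *\<^sub>C x) z = c *\<^sub>C wedge x z"
  and wedge_add_right: "wedge x (y + z) = wedge x y + wedge x z"
  and wedge_scale_right: "wedge x (c *\<^sub>C y) = c *\<^sub>C wedge x y"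
  by (simp_all add: wedge_def linext_lin linext_fun_add linext_fun_scale)

lemma wsign_Un_left:
  assumes "A \<inter> B = {}" "finite A" "finite B" "bdd_above C"
  shows "wsign (A \<union> B) C = wsign A C * wsign B C"
proof -
  have fin: "finite {(a, c). a \<in> A \<and> c \<in> C \<and> a < c}" if "finite A" for A
  proof -
    obtain u where u: "\<forall>c\<in>C. c \<le> u" using assms(4) by (auto simp: bdd_above_def)
    have "{(a, c). a \<in> A \<and> c \<in> C \<and> a < c} \<subseteq> (SIGMA a:A. {a..u})" using u by auto
    then show ?thesis using finite_subset that by blast
  qed
  have "{(a, c). a \<in> A \<union> B \<and> c \<in> C \<and> a < c} =
     {(a, c). a \<in> A \<and> c \<in> C \<and> a < c} \<union> {(a, c). a \<in> B \<and> c \<in> C \<and> a < c}" by auto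
  moreover have "{(a, c). a \<in> A \<and> c \<in> C \<and> a < c} \<inter> {(a, c). a \<in> B \<and> c \<in> C \<and> a < c} = {}"
    using assms(1) by auto
  ultimately show ?thesis
    using fin assms(2,3) by (simp add: wsign_def card_Un_disjoint power_add)
qed

lemma wsign_Un_right:
  assumes "B \<inter> C = {}" "finite A" "bdd_above B" "bdd_above C"
  shows "wsign A (B \<union> C) = wsign A B * wsign A C"
proof -
  have fin: "finite {(a, c). a \<in> A \<and> c \<in> C \<and> a < c}" if C: "bdd_above C" for C
  proof -
    obtain u where u: "\<forall>c\<in>C. c \<le> u" using C by (auto simp: bdd_above_def)
    have "{(a, c). a \<in> A \<and> c \<in> C \<and> a < c} \<subseteq> (SIGMA a:A. {a..u})" using u by auto
    then show ?thesis using finite_subset \<open>finite A\<close> by blast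
  qed
  have "{(a, c). a \<in> A \<and> c \<in> B \<union> C \<and> a < c} =
     {(a, c). a \<in> A \<and> c \<in> B \<and> a < c} \<union> {(a, c). a \<in> A \<and> c \<in> C \<and> a < c}" by auto
  moreover have "{(a, c). a \<in> A \<and> c \<in> B \<and> a < c} \<inter> {(a, c). a \<in> A \<and> c \<in> C \<and> a < c} = {}"
    using assms(1) by auto
  ultimately show ?thesis
    using fin assms(3,4) by (simp add: wsign_def card_Un_disjoint power_add)
qed

lemma wsign_singleton: "wsign {n} S = (-1) ^ n_above n S"
proof -
  have "{(a, b). a \<in> {n} \<and> b \<in> S \<and> a < b} = Pair n ` {s \<in> S. n < s}" by auto
  then show ?thesis by (simp add: wsign_def n_above_def card_image inj_on_def)
qed

lemma wsign_empty [simp]: "wsign {} B = 1" "wsign A {} = 1"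
  by (simp_all add: wsign_def)

lemma wedge_assoc_bas:
  assumes "finite A" "finite B" "bdd_above C"
  shows "wedge (wedge (bas A) (bas B)) (bas C) = wedge (bas A) (wedge (bas B) (bas C))"
proof (cases "A \<inter> B = {} \<and> A \<inter> C = {} \<and> B \<inter> C = {}")
  case True
  have b: "bdd_above B" using assms(2) by simp
  from True show ?thesis
    using wsign_Un_left[of A B C] wsign_Un_right[of B C A] assms b
    by (simp add: wedge_bas wedge_scale_left wedge_scale_right Int_Un_distrib Int_Un_distrib2 Un_assoc ac_simps)
next
  case False
  then show ?thesis
    by (auto simp: wedge_bas wedge_scale_left wedge_scale_right Int_Un_distrib Int_Un_distrib2)
       (auto simp: wedge_def)
qed

lemma wedge_assoc:
  assumes "\<forall>A\<in>keys x. finite A" "\<forall>B\<in>keys y. finite B" "\<forall>C\<in>keys z. bdd_above C"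
  shows "wedge (wedge x y) z = wedge x (wedge y z)"
proof -
  have e: "wedge u v = linext (\<lambda>A. linext (\<lambda>B. wedge (bas A) (bas B)) v) u" for u v
    by (simp add: wedge_def)
  have l: "wedge (linext f x) y = linext (\<lambda>a. wedge (f a) y) x" for f :: "int set \<Rightarrow> ext" and x y
    by (simp add: wedge_def linext_linext)
  have r: "wedge x (linext f y) = linext (\<lambda>a. wedge x (f a)) y" for f :: "int set \<Rightarrow> ext" and x y
  proof -
    have "wedge x (linext f y) = linext (\<lambda>A. linext (\<lambda>b. linext (\<lambda>B. wedge (bas A) (bas B)) (f b)) y) x"
      by (subst e) (simp add: linext_linext)
    also have "\<dots> = linext (\<lambda>b. linext (\<lambda>A. linext (\<lambda>B. wedge (bas A) (bas B)) (f b)) x) y"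
      by (rule linext_swap)
    also have "\<dots> = linext (\<lambda>a. wedge x (f a)) y"
      by (subst e) simp
    finally show ?thesis .
  qed
  have "wedge (wedge x y) z = wedge (linext (\<lambda>A. linext (\<lambda>B. wedge (bas A) (bas B)) y) x) (linext bas z)"
    by (subst e[of x y]) simp
  also have "\<dots> = linext (\<lambda>A. linext (\<lambda>B. wedge (wedge (bas A) (bas B)) (linext bas z)) y) x"
    by (simp only: l)
  also have "\<dots> = linext (\<lambda>A. linext (\<lambda>B. linext (\<lambda>C. wedge (wedge (bas A) (bas B)) (bas C)) z) y) x"
    by (simp only: r)
  also have "\<dots> = linext (\<lambda>A. linext (\<lambda>B. linext (\<lambda>C. wedge (bas A) (wedge (bas B) (bas C))) z) y) x"
    using assms by (intro linext_eqI wedge_assoc_bas) auto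
  also have "\<dots> = linext (\<lambda>A. wedge (bas A) (wedge y z)) x"
    by (subst (4) e) (simp add: r)
  also have "\<dots> = wedge (linext bas x) (wedge y z)"
    by (simp only: l)
  finally show ?thesis by simp
qed


lemma wedge_linext_left: "wedge (linext f x) y = linext (\<lambda>a. wedge (f a) y) x"
  by (simp add: wedge_def linext_linext)

lemma wedge_bas_singleton: "wedge (bas {n}) = psis n"
  by (rule ext) (auto simp: wedge_def psis_def wsign_singleton intro!: linext_eqI)

lemma vop_linext: "vop v x = linext (\<lambda>n. psis n x) v"
  by (simp add: vop_def emb_def wedge_linext_left wedge_bas_singleton)

lemma vop_bas: "vop (bas n) = psis n"
  by (rule ext) (simp add: vop_linext)

lemma psis_bas: "psis n (bas S) = (if n \<in> S then 0 else (-1) ^ n_above n S *\<^sub>C bas (insert n S))"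
  by (simp add: psis_def)
lemma psi_bas: "psi n (bas S) = (if n \<in> S then (-1) ^ n_above n S *\<^sub>C bas (S - {n}) else 0)"
  by (simp add: psi_def)

lemma psis_lin: "psis n (x + y) = psis n x + psis n y" "psis n (c *\<^sub>C x) = c *\<^sub>C psis n x"
  by (simp_all add: psis_def linext_lin)
lemma psi_lin: "psi n (x + y) = psi n x + psi n y" "psi n (c *\<^sub>C x) = c *\<^sub>C psi n x"
  by (simp_all add: psi_def linext_lin)
lemma psis_0 [simp]: "psis n 0 = 0" and psi_0 [simp]: "psi n 0 = 0"
  by (simp_all add: psis_def psi_def)
lemma psis_linext: "psis n (linext f x) = linext (\<lambda>a. psis n (f a)) x"
  by (simp add: psis_def linext_linext)
lemma psi_linext: "psi n (linext f x) = linext (\<lambda>a. psi n (f a)) x"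
  by (simp add: psi_def linext_linext)

lemma finite_above: "bdd_above S \<Longrightarrow> finite {s \<in> S. (n::int) < s}"
proof -
  assume "bdd_above S"
  then obtain u where u: "\<forall>c\<in>S. c \<le> u" by (auto simp: bdd_above_def)
  have "{s \<in> S. n < s} \<subseteq> {n..u}" using u by auto
  then show ?thesis using finite_subset by blast
qed

lemma n_above_insert:
  assumes "bdd_above S" "k \<notin> S"
  shows "n_above n (insert k S) = n_above n S + (if n < k then 1 else 0)"
proof -
  have "{s \<in> insert k S. n < s} = (if n < k then insert k {s \<in> S. n < s} else {s \<in> S. n < s})" by auto
  moreover have "k \<notin> {s \<in> S. n < s}" using assms by auto
  ultimately show ?thesis using finite_above[OF assms(1), of n] by (simp add: n_above_def del: mem_Collect_eq)
qed

lemma n_above_remove: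
  assumes "bdd_above S" "k \<in> S"
  shows "n_above n S = n_above n (S - {k}) + (if n < k then 1 else 0)"
  using n_above_insert[of "S - {k}" k n] assms
  by (simp add: insert_absorb bdd_above_mono[of S "S - {k}"])

lemma n_above_self [simp]: "n_above n (insert n S) = n_above n S" "n_above n (S - {n}) = n_above n S"
  by (auto simp: n_above_def intro: arg_cong[of _ _ card])

text \<open>The canonical anticommutation relations; the set-indexed model satisfies them on all
  combinations of \<open>bas S\<close> with \<open>S\<close> bounded above.\<close>

lemma acomm_psis:
  assumes "\<forall>S\<in>keys x. bdd_above S"
  shows "psis k (psis l x) + psis l (psis k x) = 0"
proof -
  have "psis k (psis l (bas S)) + psis l (psis k (bas S)) = 0" if S: "bdd_above S" for S
  proof (cases "k \<in> S \<or> l \<in> S \<or> k = l")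
    case True then show ?thesis by (auto simp: psis_bas psis_lin)
  next
    case False then show ?thesis using S
      by (cases "k < l") (auto simp: psis_bas psis_lin n_above_insert insert_commute[of k l])
  qed
  then have "linext (\<lambda>S. psis k (psis l (bas S)) + psis l (psis k (bas S))) x = linext (\<lambda>_. 0) x"
    using assms by (intro linext_eqI) auto
  then have "psis k (psis l (linext bas x)) + psis l (psis k (linext bas x)) = 0"
    by (simp only: psis_linext linext_fun_add linext_fun_zero)
  then show ?thesis by simp
qed

lemma acomm_psi:
  assumes "\<forall>S\<in>keys x. bdd_above S"
  shows "psi k (psi l x) + psi l (psi k x) = 0"
proof -
  have "psi k (psi l (bas S)) + psi l (psi k (bas S)) = 0" if S: "bdd_above S" for S
  proof (cases "k \<notin> S \<or> l \<notin> S \<or> k = l")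
    case True then show ?thesis by (auto simp: psi_bas psi_lin)
  next
    case False
    then have eq: "S - {k} - {l} = S - {l} - {k}" by auto
    have "n_above k S = n_above k (S - {l}) + (if k < l then 1 else 0)"
       "n_above l S = n_above l (S - {k}) + (if l < k then 1 else 0)"
      using False S by (intro n_above_remove; simp)+
    then have "(-1) ^ n_above l S * (-1) ^ n_above k (S - {l}) =
        - ((-1) ^ n_above k S * (-1) ^ n_above l (S - {k}) :: complex)"
      using False by (cases "k < l") auto
    moreover have "k \<in> S" "l \<in> S" "k \<noteq> l" using False by auto
    ultimately show ?thesis
      by (simp add: psi_bas psi_lin eq)
  qed
  then have "linext (\<lambda>S. psi k (psi l (bas S)) + psi l (psi k (bas S))) x = linext (\<lambda>_. 0) x"
    using assms by (intro linext_eqI) auto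
  then have "psi k (psi l (linext bas x)) + psi l (psi k (linext bas x)) = 0"
    by (simp only: psi_linext linext_fun_add linext_fun_zero)
  then show ?thesis by simp
qed

lemma acomm_psi_psis:
  assumes "\<forall>S\<in>keys x. bdd_above S"
  shows "psi k (psis l x) + psis l (psi k x) = (if k = l then x else 0)"
proof -
  have "psi k (psis l (bas S)) + psis l (psi k (bas S)) = (if k = l then bas S else 0)"
    if S: "bdd_above S" for S
  proof (cases "k = l")
    case True
    then show ?thesis
      by (auto simp: psi_bas psis_bas psi_lin psis_lin insert_absorb simp flip: power_add mult_2)
  next
    case False
    show ?thesis
    proof (cases "k \<in> S \<and> l \<notin> S")
      case True
      have "n_above l S = n_above l (S - {k}) + (if l < k then 1 else 0)"
           "n_above k (insert l S) = n_above k S + (if k < l then 1 else 0)"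
        using True S n_above_remove n_above_insert by blast+
      then have "(-1) ^ n_above l S * (-1) ^ n_above k (insert l S) =
          - ((-1) ^ n_above k S * (-1) ^ n_above l (S - {k}) :: complex)"
        using False by (cases "k < l") auto
      then show ?thesis using True False
        by (simp add: psi_bas psis_bas psi_lin psis_lin insert_Diff_if)
    next
      case b: False
      then show ?thesis using False
        by (auto simp: psi_bas psis_bas psi_lin psis_lin)
    qed
  qed
  then have "linext (\<lambda>S. psi k (psis l (bas S)) + psis l (psi k (bas S))) x =
      linext (\<lambda>S. if k = l then bas S else 0) x"
    using assms by (intro linext_eqI) auto
  then have "psi k (psis l (linext bas x)) + psis l (psi k (linext bas x)) = (if k = l then x else 0)"
    by (cases "k = l") (simp_all add: psi_linext psis_linext linext_fun_add del: linext_bas_id,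
        simp add: linext_bas_id)
  then show ?thesis by simp
qed

lemma psi_vac: "0 < n \<Longrightarrow> psi n (vac 0) = 0"
  and psis_vac: "n \<le> 0 \<Longrightarrow> psis n (vac 0) = 0"
  by (simp_all add: vac_def psi_bas psis_bas)

lemma psis_vac_succ: "psis m (vac (m - 1)) = vac m"
proof -
  have "{s \<in> {..m - 1}. m < s} = {}" by auto
  then have "n_above m {..m - 1} = 0" unfolding n_above_def by (metis card.empty)
  moreover have "m \<notin> {..m - 1}" "insert m {..m - 1} = {..m}" by auto
  ultimately show ?thesis by (simp add: vac_def psis_bas del: atMost_iff)
qed

lemma keys_linext: "keys (linext f x) \<subseteq> (\<Union>a\<in>keys x. keys (f a))"
proof -
  have "keys (linext f x) \<subseteq> (\<Union>a\<in>keys x. keys (lookup x a *\<^sub>C f a))"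
    unfolding linext_def by (rule keys_sum)
  also have "\<dots> \<subseteq> (\<Union>a\<in>keys x. keys (f a))" by (auto simp: in_keys_iff)
  finally show ?thesis .
qed

lemma keys_bas [simp]: "keys (bas a) = {a}" by (simp add: bas_def)
lemma keys_scale: "keys (c *\<^sub>C x) \<subseteq> keys x" by (auto simp: in_keys_iff)

lemma keys_psis: assumes "T \<in> keys (psis n x)" shows "\<exists>S\<in>keys x. T = insert n S"
proof -
  obtain S where S: "S \<in> keys x" "T \<in> keys (if n \<in> S then 0 else (-1) ^ n_above n S *\<^sub>C bas (insert n S))"
    by (rule UN_E[OF subsetD[OF keys_linext assms[unfolded psis_def]]])
  then have "T \<in> keys (bas (insert n S) :: ext)" using subsetD[OF keys_scale] by (auto split: if_split_asm simp del: keys_bas)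
  then show ?thesis using S(1) by auto
qed

lemma keys_psi: assumes "T \<in> keys (psi n x)" shows "\<exists>S\<in>keys x. T = S - {n}"
proof -
  obtain S where S: "S \<in> keys x" "T \<in> keys (if n \<in> S then (-1) ^ n_above n S *\<^sub>C bas (S - {n}) else 0)"
    by (rule UN_E[OF subsetD[OF keys_linext assms[unfolded psi_def]]])
  then have "T \<in> keys (bas (S - {n}) :: ext)" using subsetD[OF keys_scale] by (auto split: if_split_asm simp del: keys_bas)
  then show ?thesis using S(1) by auto
qed

lemma bdd_psis: "\<forall>S\<in>keys x. bdd_above S \<Longrightarrow> \<forall>S\<in>keys (psis n x). bdd_above S"
  by (auto dest!: keys_psis)

lemma bdd_psi: "\<forall>S\<in>keys x. bdd_above S \<Longrightarrow> \<forall>S\<in>keys (psi n x). bdd_above S"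
  using keys_psi by (metis Diff_subset bdd_above_mono)

lemma bdd_vop: "\<forall>S\<in>keys x. bdd_above S \<Longrightarrow> \<forall>S\<in>keys (vop v x). bdd_above S"
proof
  fix S assume *: "\<forall>S\<in>keys x. bdd_above S" and "S \<in> keys (vop v x)"
  then obtain n where "S \<in> keys (psis n x)"
    unfolding vop_linext by (blast dest: subsetD[OF keys_linext])
  then show "bdd_above S" by (rule bdd_psis[OF *, rule_format])
qed

lemma vop_lin: "vop v (x + y) = vop v x + vop v y" "vop v (c *\<^sub>C x) = c *\<^sub>C vop v x"
  "vop (v + w) x = vop v x + vop w x" "vop (c *\<^sub>C v) x = c *\<^sub>C vop v x"
  by (simp_all add: vop_linext psis_lin linext_lin linext_fun_add linext_fun_scale)

lemma vop_0 [simp]: "vop v 0 = 0" "vop 0 x = 0" by (simp_all add: vop_linext)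

lemma vop_linext_right: "vop v (linext f x) = linext (\<lambda>a. vop v (f a)) x"
  by (simp add: vop_linext psis_linext linext_swap[of _ x])

lemma acomm_vop:
  assumes "\<forall>S\<in>keys x. bdd_above S"
  shows "vop v (vop w x) = - vop w (vop v x)"
proof -
  have "vop v (vop w x) + vop w (vop v x) =
     linext (\<lambda>n. linext (\<lambda>k. psis n (psis k x)) w) v + linext (\<lambda>n. linext (\<lambda>k. psis n (psis k x)) v) w"
    by (simp add: vop_linext psis_linext)
  also have "\<dots> = linext (\<lambda>n. linext (\<lambda>k. psis n (psis k x) + psis k (psis n x)) w) v"
    by (simp add: linext_fun_add linext_swap[of _ v w])
  also have "\<dots> = 0" using assms by (simp add: acomm_psis)
  finally show ?thesis by (simp add: eq_neg_iff_add_eq_0)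
qed

lemma vop_vop_self:
  assumes "\<forall>S\<in>keys x. bdd_above S"
  shows "vop v (vop v x) = 0"
proof -
  have "vop v (vop v x) = - vop v (vop v x)" by (rule acomm_vop[OF assms])
  then have "2 *\<^sub>C vop v (vop v x) = 0"
    using pm.scale_left_distrib[of 1 1 "vop v (vop v x)"] by (simp add: eq_neg_iff_add_eq_0)
  then show ?thesis by simp
qed

lemma rev_sorted_insert_max:
  assumes "finite A" "\<forall>a\<in>A. a < (b::int)"
  shows "rev (sorted_list_of_set (insert b A)) = b # rev (sorted_list_of_set A)"
proof -
  have "sorted_list_of_set (insert b A) = sorted_list_of_set A @ [b]"
  proof (rule sorted_distinct_set_unique)
    show "sorted (sorted_list_of_set A @ [b])"
      using assms by (auto simp: sorted_append less_imp_le)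
    show "distinct (sorted_list_of_set A @ [b])"
      using assms by auto
    show "set (sorted_list_of_set (insert b A)) = set (sorted_list_of_set A @ [b])"
      using assms by (simp del: sorted_list_of_set_insert_remove)
  qed (rule sorted_sorted_list_of_set distinct_sorted_list_of_set)+
  then show ?thesis by simp
qed

lemma img_wedge_empty [simp]: "img_wedge g {} z = z" by (simp add: img_wedge_def)

lemma img_wedge_insert_max:
  assumes "finite A" "\<forall>a\<in>A. a < b"
  shows "img_wedge g (insert b A) z = vop (g (bas b)) (img_wedge g A z)"
  unfolding img_wedge_def rev_sorted_insert_max[OF assms] by simp

lemma bdd_img_wedge:
  assumes "\<forall>S\<in>keys z. bdd_above S" "finite A"
  shows "\<forall>S\<in>keys (img_wedge g A z). bdd_above S"
  using assms(2)
proof (induction A rule: finite_linorder_max_induct)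
  case empty show ?case using assms(1) by simp
next
  case (insert b A)
  show ?case unfolding img_wedge_insert_max[OF insert.hyps] by (rule bdd_vop[OF insert.IH])
qed

lemma img_wedge_insert:
  assumes "\<forall>S\<in>keys z. bdd_above S" "finite A"
  shows "vop (g (bas n)) (img_wedge g A z) =
    (if n \<in> A then 0 else (-1) ^ n_above n A *\<^sub>C img_wedge g (insert n A) z)"
  using assms(2)
proof (induction A rule: finite_linorder_max_induct)
  case empty
  show ?case using img_wedge_insert_max[of "{}" n g z] by (simp add: n_above_def)
next
  case (insert b A)
  let ?I = "\<lambda>A. img_wedge g A z" and ?v = "\<lambda>n. vop (g (bas n))"
  have bd: "\<forall>S\<in>keys (?I A). bdd_above S" by (rule bdd_img_wedge[OF assms(1) insert.hyps(1)])
  have eq: "?I (insert b A) = ?v b (?I A)" using insert.hyps by (intro img_wedge_insert_max) auto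
  have bA: "b \<notin> A" "bdd_above A" using insert.hyps by auto
  consider "n = b" | "b < n" | "n < b" by linarith
  then show ?case
  proof cases
    case 1 then show ?thesis using eq bd by (simp add: vop_vop_self)
  next
    case 2
    then have lt: "\<forall>a\<in>insert b A. a < n" using insert.hyps by auto
    then have "{s \<in> insert b A. n < s} = {}" by force
    then have "n_above n (insert b A) = 0" unfolding n_above_def by (metis card.empty)
    moreover have "n \<notin> insert b A" using lt by auto
    moreover have "finite (insert b A)" using insert.hyps by simp
    ultimately show ?thesis using lt by (simp add: img_wedge_insert_max[of "insert b A" n])
  next
    case 3
    have *: "?v n (?I (insert b A)) = - ?v b (?v n (?I A))" unfolding eq by (rule acomm_vop[OF bd])
    show ?thesis
    proof (cases "n \<in> A")
      case True then show ?thesis using * insert.IH by simp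
    next
      case False
      have "?I (insert n (insert b A)) = ?v b (?I (insert n A))"
        using insert.hyps 3 by (subst insert_commute, intro img_wedge_insert_max) auto
      then show ?thesis using * insert.IH False 3 bA
        by (simp add: vop_lin n_above_insert)
    qed
  qed
qed

lemma n_above_Un:
  assumes "bdd_above A" "bdd_above B" "A \<inter> B = {}"
  shows "n_above n (A \<union> B) = n_above n A + n_above n B"
proof -
  have "{s \<in> A \<union> B. n < s} = {s \<in> A. n < s} \<union> {s \<in> B. n < s}" by auto
  moreover have "{s \<in> A. n < s} \<inter> {s \<in> B. n < s} = {}" using assms by auto
  ultimately show ?thesis using assms finite_above by (simp add: n_above_def card_Un_disjoint)
qed

lemma finite_win [simp]: "finite (win N)" by (simp add: win_def)

lemma fock_act_bas: "fock_act N g (bas S) =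
   wsign (S \<inter> win N) (S - win N) *\<^sub>C img_wedge g (S \<inter> win N) (bas (S - win N))"
  by (simp add: fock_act_def)

lemma fock_act_lin: "fock_act N g (x + y) = fock_act N g x + fock_act N g y"
  "fock_act N g (c *\<^sub>C x) = c *\<^sub>C fock_act N g x"
  "fock_act N g 0 = 0"
  by (simp_all add: fock_act_def linext_lin)

lemma fock_act_linext: "fock_act N g (linext f x) = linext (\<lambda>a. fock_act N g (f a)) x"
  by (simp add: fock_act_def linext_linext)

lemma fock_act_psis:
  assumes "n \<in> win N" "\<forall>S\<in>keys x. bdd_above S"
  shows "fock_act N g (psis n x) = vop (g (bas n)) (fock_act N g x)"
proof -
  have "fock_act N g (psis n (bas S)) = vop (g (bas n)) (fock_act N g (bas S))" if S: "bdd_above S" for S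
  proof -
    let ?A = "S \<inter> win N" and ?B = "S - win N"
    have B: "bdd_above ?B" using S by (rule bdd_above_mono) auto
    have S': "S = ?A \<union> ?B" by auto
    have A: "finite ?A" "bdd_above ?A" by auto
    show ?thesis
    proof (cases "n \<in> S")
      case True
      then show ?thesis using A B assms(1)
        by (simp add: psis_bas fock_act_lin(3) fock_act_bas vop_lin img_wedge_insert)
    next
      case False
      have i: "win N \<inter> insert n S = insert n ?A" "insert n S \<inter> win N = insert n ?A" "insert n S - win N = ?B" using assms(1) by auto
      have w: "wsign (insert n ?A) ?B = (-1) ^ n_above n ?B * wsign ?A ?B"
        using wsign_Un_left[of "{n}" ?A ?B] False A B by (simp add: wsign_singleton)
      have "n_above n S = n_above n ?A + n_above n ?B"
        using n_above_Un[of ?A ?B n] A B by (metis Int_Diff_disjoint S' Diff_disjoint Int_assoc Int_empty_right inf_commute)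
      then show ?thesis using A B False
        by (simp add: psis_bas fock_act_lin fock_act_bas vop_lin img_wedge_insert i w power_add ac_simps)
    qed
  qed
  then have "linext (\<lambda>S. fock_act N g (psis n (bas S))) x = linext (\<lambda>S. vop (g (bas n)) (fock_act N g (bas S))) x"
    using assms by (intro linext_eqI) auto
  then have "fock_act N g (psis n (linext bas x)) = vop (g (bas n)) (fock_act N g (linext bas x))"
    by (simp only: psis_linext fock_act_linext vop_linext_right)
  then show ?thesis by simp
qed

lemma V_keys: assumes "v \<in> V N" shows "keys v \<subseteq> win N"
proof -
  have "pm.subspace {v. keys v \<subseteq> win N}"
    unfolding pm.subspace_def
    by (auto dest!: subsetD[OF Poly_Mapping.keys_add] subsetD[OF keys_scale])
  moreover have "alpha_vec ` {1..N} \<union> beta_vec ` {1..N} \<subseteq> {v. keys v \<subseteq> win N}"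
    by (auto simp: alpha_vec_def beta_vec_def win_def)
  ultimately have "V N \<subseteq> {v. keys v \<subseteq> win N}" unfolding V_def by (rule pm.span_minimal[rotated])
  then show ?thesis using assms by auto
qed

lemma linear_linext_expand:
  fixes g :: "('a \<Rightarrow>\<^sub>0 complex) \<Rightarrow> ('b \<Rightarrow>\<^sub>0 complex)"
  assumes "Vector_Spaces.linear cscale cscale g"
  shows "g v = linext (\<lambda>a. g (bas a)) v"
proof -
  interpret g: Vector_Spaces.linear cscale cscale g by fact
  have "g (linext bas v) = linext (\<lambda>a. g (bas a)) v"
    unfolding linext_def by (simp add: g.sum g.scale)
  then show ?thesis by simp
qed

lemma fock_act_vop:
  assumes "Vector_Spaces.linear cscale cscale g" "v \<in> V N" "\<forall>S\<in>keys x. bdd_above S"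
  shows "fock_act N g (vop v x) = vop (g v) (fock_act N g x)"
proof -
  have "fock_act N g (vop v x) = linext (\<lambda>n. fock_act N g (psis n x)) v"
    by (simp add: vop_linext fock_act_linext)
  also have "\<dots> = linext (\<lambda>n. vop (g (bas n)) (fock_act N g x)) v"
    using V_keys[OF assms(2)] assms(3) by (intro linext_eqI fock_act_psis) auto
  also have "\<dots> = vop (g v) (fock_act N g x)"
    by (subst linear_linext_expand[OF assms(1), of v]) (simp add: vop_linext linext_linext)
  finally show ?thesis .
qed

lemma fock_act_formula:
  assumes g: "Vector_Spaces.linear cscale cscale g"
    and vs: "\<forall>v\<in>set vs. v \<in> V N"
    and ys: "\<forall>y\<in>set ys. \<exists>n>N. y \<in> {alpha n, beta n, alpha_star n, beta_star n}"
  shows "fock_act N g (foldr vop vs (foldr (\<lambda>y. y) ys (vac (- int N)))) =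
    foldr vop (map g vs) (foldr (\<lambda>y. y) ys (vac (- int N)))"
proof -
  let ?y = "foldr (\<lambda>y. y) ys (vac (- int N))"
  have y: "\<forall>S\<in>keys ?y. bdd_above S \<and> S \<inter> win N = {}"
    using ys
  proof (induction ys)
    case Nil
    show ?case by (auto simp: vac_def win_def)
  next
    case (Cons y ys)
    let ?z = "foldr (\<lambda>y. y) ys (vac (- int N))"
    have IH: "\<forall>S\<in>keys ?z. bdd_above S \<and> S \<inter> win N = {}" using Cons by auto
    obtain n where n: "n \<notin> win N" "y = psis n \<or> y = psi n"
    proof -
      from Cons.prems obtain k where "k > N" "y \<in> {alpha k, beta k, alpha_star k, beta_star k}" by auto
      then show ?thesis using that[of "int k"] that[of "- (int k - 1)"]
        by (auto simp: win_def alpha_def beta_def alpha_star_def beta_star_def)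
    qed
    have "\<forall>S\<in>keys (psis n ?z). S \<inter> win N = {}" "\<forall>S\<in>keys (psi n ?z). S \<inter> win N = {}"
      using IH n(1) by (auto dest!: keys_psis keys_psi)
    moreover have "\<forall>S\<in>keys (psis n ?z). bdd_above S" "\<forall>S\<in>keys (psi n ?z). bdd_above S"
      by (rule bdd_psis bdd_psi, use IH in simp)+
    moreover have "foldr (\<lambda>y. y) (y # ys) (vac (- int N)) = psis n ?z \<or>
        foldr (\<lambda>y. y) (y # ys) (vac (- int N)) = psi n ?z"
      using n(2) by auto
    ultimately show ?case by (elim disjE) simp_all
  qed
  have "fock_act N g ?y = ?y"
  proof -
    have "fock_act N g ?y = linext (\<lambda>S. bas S) ?y"
      unfolding fock_act_def using y by (intro linext_eqI) (auto simp: Diff_triv)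
    then show ?thesis by simp
  qed
  moreover have "fock_act N g (foldr vop vs ?y) = foldr vop (map g vs) (fock_act N g ?y) \<and>
      (\<forall>S\<in>keys (foldr vop vs ?y). bdd_above S)"
    using vs by (induction vs) (use y g in \<open>auto simp: fock_act_vop dest: bdd_vop[rule_format, rotated]\<close>)
  ultimately show ?thesis by simp
qed

text \<open>The monomials spanning \<open>fock m\<close> are, up to sign, the distinct \<open>bas S\<close> with
  \<open>S \<in> occupied m\<close>, so they form a basis.\<close>

definition occupied :: "int \<Rightarrow> int set set"
  where "occupied m = {S. finite (S \<inter> {0<..}) \<and> finite ({..0} - S) \<and>
    int (card (S \<inter> {0<..})) = int (card ({..0} - S)) + m}"

lemma foldr_psis:
  assumes "distinct ss" "set ss \<inter> S = {}"
  shows "\<exists>c\<in>{1, -1}. foldr psis ss (bas S) = c *\<^sub>C bas (set ss \<union> S)"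
  using assms
proof (induction ss)
  case (Cons n ss)
  then have "\<exists>c\<in>{1, -1}. foldr psis ss (bas S) = c *\<^sub>C bas (set ss \<union> S)"
    by (intro Cons.IH) auto
  then obtain c where c: "c \<in> {1, -1}" "foldr psis ss (bas S) = c *\<^sub>C bas (set ss \<union> S)" ..
  moreover have "n \<notin> set ss \<union> S" using Cons.prems by auto
  ultimately have "foldr psis (n # ss) (bas S) =
      (c * (-1) ^ n_above n (set ss \<union> S)) *\<^sub>C bas (set (n # ss) \<union> S)"
    by (simp add: psis_lin psis_bas)
  moreover have "c * (-1) ^ n_above n (set ss \<union> S) \<in> {1, -1}"
    using c(1) by (cases "even (n_above n (set ss \<union> S))") auto
  ultimately show ?case by blast
qed auto

lemma foldr_psi:
  assumes "distinct rs" "set rs \<subseteq> S"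
  shows "\<exists>c\<in>{1, -1}. foldr psi rs (bas S) = c *\<^sub>C bas (S - set rs)"
  using assms
proof (induction rs)
  case (Cons n rs)
  then have "\<exists>c\<in>{1, -1}. foldr psi rs (bas S) = c *\<^sub>C bas (S - set rs)"
    by (intro Cons.IH) auto
  then obtain c where c: "c \<in> {1, -1}" "foldr psi rs (bas S) = c *\<^sub>C bas (S - set rs)" ..
  moreover have "n \<in> S - set rs" "S - set rs - {n} = S - set (n # rs)" using Cons.prems by auto
  ultimately have "foldr psi (n # rs) (bas S) =
      (c * (-1) ^ n_above n (S - set rs)) *\<^sub>C bas (S - set (n # rs))"
    by (simp add: psi_lin psi_bas)
  moreover have "c * (-1) ^ n_above n (S - set rs) \<in> {1, -1}"
    using c(1) by (cases "even (n_above n (S - set rs))") auto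
  ultimately show ?case by blast
qed auto

lemma fock_monomial:
  assumes "sorted_wrt (<) rs" "sorted_wrt (<) ss" "\<forall>r\<in>set rs. r \<le> (0::int)" "\<forall>s\<in>set ss. 0 < s"
  shows "\<exists>c\<in>{1, -1}. foldr psi rs (foldr psis ss (vac 0)) = c *\<^sub>C bas (set ss \<union> {..0} - set rs)"
proof -
  have d: "distinct rs" "distinct ss" using assms strict_sorted_iff by auto
  obtain c where c: "c \<in> {1, -1}" "foldr psis ss (vac 0) = c *\<^sub>C bas (set ss \<union> {..0})"
    using foldr_psis[of ss "{..0}"] d assms(4) unfolding vac_def by force
  obtain c' where c': "c' \<in> {1, -1}"
    "foldr psi rs (bas (set ss \<union> {..0})) = c' *\<^sub>C bas (set ss \<union> {..0} - set rs)"
    using foldr_psi[of rs "set ss \<union> {..0}"] d assms(3) by force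
  have "foldr psi rs (c *\<^sub>C x) = c *\<^sub>C foldr psi rs x" for x
    by (induction rs) (simp_all add: psi_lin)
  then have "foldr psi rs (foldr psis ss (vac 0)) = (c * c') *\<^sub>C bas (set ss \<union> {..0} - set rs)"
    using c c' by simp
  moreover have "c * c' \<in> {1, -1}" using c(1) c'(1) by auto
  ultimately show ?thesis by blast
qed

lemma fock_eq: "fock m = {x. keys x \<subseteq> occupied m}"
proof
  have sub: "pm.subspace {x :: ext. keys x \<subseteq> occupied m}"
    unfolding pm.subspace_def
    by (auto dest!: subsetD[OF Poly_Mapping.keys_add] subsetD[OF keys_scale])
  show "fock m \<subseteq> {x. keys x \<subseteq> occupied m}"
    unfolding fock_def
  proof (rule pm.span_minimal[OF _ sub], rule subsetI)
    fix x assume "x \<in> fock_monomials m"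
    then obtain rs ss where x: "x = foldr psi rs (foldr psis ss (vac 0))"
      and h: "sorted_wrt (<) rs" "sorted_wrt (<) ss" "\<forall>r\<in>set rs. r \<le> 0" "\<forall>s\<in>set ss. 0 < s"
        "int (length ss) = int (length rs) + m"
      unfolding fock_monomials_def by blast
    let ?S = "set ss \<union> {..0} - set rs"
    have "?S \<inter> {0<..} = set ss" "{..0} - ?S = set rs" using h by force+
    moreover have "card (set ss) = length ss" "card (set rs) = length rs"
      using h strict_sorted_iff distinct_card by metis+
    ultimately have "?S \<in> occupied m" using h(5) unfolding occupied_def by simp
    moreover obtain c where "x = c *\<^sub>C bas ?S" using fock_monomial[OF h(1-4)] x by blast
    then have "keys x \<subseteq> {?S}" using keys_scale[of c "bas ?S"] by simp
    ultimately show "x \<in> {x. keys x \<subseteq> occupied m}" by blast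
  qed
  have bas: "bas S \<in> fock m" if S: "S \<in> occupied m" for S
  proof -
    let ?ss = "sorted_list_of_set (S \<inter> {0<..})" and ?rs = "sorted_list_of_set ({..0} - S)"
    have fin: "finite (S \<inter> {0<..})" "finite ({..0} - S)" using S by (auto simp: occupied_def)
    have S': "set ?ss \<union> {..0} - set ?rs = S" using fin by force
    have "\<exists>c\<in>{1, -1}. foldr psi ?rs (foldr psis ?ss (vac 0)) = c *\<^sub>C bas (set ?ss \<union> {..0} - set ?rs)"
      by (rule fock_monomial) (use fin in auto)
    then obtain c where c: "c \<in> {1, -1}" "foldr psi ?rs (foldr psis ?ss (vac 0)) = c *\<^sub>C bas S"
      unfolding S' by blast
    have "foldr psi ?rs (foldr psis ?ss (vac 0)) \<in> fock_monomials m"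
      unfolding fock_monomials_def using fin S
      by (intro CollectI exI[of _ ?rs] exI[of _ ?ss]) (auto simp: occupied_def)
    then have "c *\<^sub>C bas S \<in> fock m" unfolding c fock_def by (rule pm.span_base)
    then have "c *\<^sub>C (c *\<^sub>C bas S) \<in> fock m" unfolding fock_def by (rule pm.span_scale)
    then show ?thesis using c(1) by auto
  qed
  show "{x. keys x \<subseteq> occupied m} \<subseteq> fock m"
  proof
    fix x :: ext assume "x \<in> {x. keys x \<subseteq> occupied m}"
    then have "linext bas x \<in> fock m"
      using bas unfolding linext_def fock_def by (intro pm.span_sum pm.span_scale) auto
    then show "x \<in> fock m" by simp
  qed
qed

lemma ext_map_fixed:
  assumes "finite A" "\<forall>a\<in>A. g (bas a) = bas a"
  shows "img_wedge g A (bas {}) = bas A"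
  using assms
proof (induction A rule: finite_linorder_max_induct)
  case (insert b A)
  have "{s \<in> A. b < s} = {}" using insert.hyps by force
  then have "n_above b A = 0" unfolding n_above_def by (metis card.empty)
  moreover have "b \<notin> A" using insert.hyps by auto
  ultimately show ?case using insert
    by (simp add: img_wedge_insert_max vop_bas psis_bas)
qed simp

lemma Sp_mono:
  assumes "N \<le> N'"
  shows "carrier (Sp N) \<subseteq> carrier (Sp N')"
proof
  fix g assume "g \<in> carrier (Sp N)"
  then have lin: "Vector_Spaces.linear cscale cscale g" and bij: "bij_betw g (V N) (V N)"
    and fix_g: "\<And>i. N < i \<Longrightarrow> g (alpha_vec i) = alpha_vec i \<and> g (beta_vec i) = beta_vec i"
    and eta: "ext_map g (eta N) = eta N"
    by (auto simp: Sp_def)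
  interpret g: Vector_Spaces.linear cscale cscale g by fact
  let ?V' = "pm.span (alpha_vec ` {N<..N'} \<union> beta_vec ` {N<..N'})"
  have split: "V N' = {x + y | x y. x \<in> V N \<and> y \<in> ?V'}"
  proof -
    have "{1..N'} = {1..N} \<union> {N<..N'}" using assms by auto
    then have "alpha_vec ` {1..N'} \<union> beta_vec ` {1..N'} =
       (alpha_vec ` {1..N} \<union> beta_vec ` {1..N}) \<union> (alpha_vec ` {N<..N'} \<union> beta_vec ` {N<..N'})"
      by (auto simp: image_Un)
    then show ?thesis unfolding V_def by (simp only: pm.span_Un)
  qed
  have idV: "g y = y" if "y \<in> ?V'" for y
    using that
  proof (induction rule: pm.span_induct_alt)
    case base show ?case by (rule g.zero)
  next
    case (step c x y)
    then have "g x = x" using fix_g by auto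
    then show ?case using step by (simp add: g.add g.scale)
  qed
  have disj: "x = 0" if "x \<in> V N" "x \<in> ?V'" for x
  proof -
    have "pm.subspace {v. keys v \<inter> win N = {}}"
      unfolding pm.subspace_def
      by (auto dest!: subsetD[OF Poly_Mapping.keys_add] subsetD[OF keys_scale])
    moreover have "alpha_vec ` {N<..N'} \<union> beta_vec ` {N<..N'} \<subseteq> {v. keys v \<inter> win N = {}}"
      by (auto simp: alpha_vec_def beta_vec_def win_def)
    ultimately have "?V' \<subseteq> {v. keys v \<inter> win N = {}}" by (rule pm.span_minimal[rotated])
    then have "keys x \<inter> win N = {}" using that(2) by blast
    then have "keys x = {}" using V_keys[OF that(1)] by blast
    then show ?thesis unfolding Poly_Mapping.keys_eq_empty .
  qed
  have gV: "g x \<in> V N" if "x \<in> V N" for x using bij that by (auto simp: bij_betw_def)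
  have "bij_betw g (V N') (V N')"
    unfolding bij_betw_def
  proof
    show "inj_on g (V N')"
    proof (rule inj_onI)
      fix u u' assume u: "u \<in> V N'" "u' \<in> V N'" "g u = g u'"
      then obtain x y x' y' where d: "u = x + y" "u' = x' + y'" "x \<in> V N" "y \<in> ?V'" "x' \<in> V N" "y' \<in> ?V'"
        unfolding split by auto
      have e: "g x + y = g x' + y'" using u(3) d by (simp add: g.add idV)
      then have eq: "g x - g x' = y' - y" by (simp add: algebra_simps)
      have "g x - g x' \<in> V N" using gV d unfolding V_def by (auto intro: pm.span_diff)
      moreover have "y' - y \<in> ?V'" using d by (auto intro: pm.span_diff)
      ultimately have "g x - g x' = 0" using disj eq by metis
      then have "g x = g x'" "y = y'" using e by auto
      then show "u = u'" using bij d by (auto simp: bij_betw_def dest: inj_onD)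
    qed
    show "g ` V N' = V N'"
    proof (intro equalityI subsetI)
      fix z assume "z \<in> g ` V N'"
      then obtain x y where "z = g (x + y)" "x \<in> V N" "y \<in> ?V'" unfolding split by auto
      then have "z = g x + y" "g x \<in> V N" "y \<in> ?V'" using idV gV by (simp_all add: g.add)
      then show "z \<in> V N'" unfolding split by blast
    next
      fix z assume "z \<in> V N'"
      then obtain x y where z: "z = x + y" "x \<in> V N" "y \<in> ?V'" unfolding split by auto
      have "x \<in> g ` V N" using z(2) bij_betw_imp_surj_on[OF bij] by simp
      then obtain x' where x': "x = g x'" "x' \<in> V N" by (rule imageE)
      have "z = g (x' + y)" unfolding g.add idV[OF z(3)] z(1) x'(1) ..
      moreover have "x' + y \<in> V N'" unfolding split using x'(2) z(3) by blast
      ultimately show "z \<in> g ` V N'" by (rule image_eqI)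
    qed
  qed
  moreover have "ext_map g (eta N') = eta N'"
  proof -
    let ?w = "\<lambda>i. wedge (emb (alpha_vec i)) (emb (beta_vec i))"
    have "{1..N'} = {1..N} \<union> {N<..N'}" "{1..N} \<inter> {N<..N'} = {}" using assms by auto
    then have s: "eta N' = eta N + sum ?w {N<..N'}"
      by (simp add: eta_def sum.union_disjoint)
    have "ext_map g (?w i) = ?w i" if "i \<in> {N<..N'}" for i
    proof -
      let ?A = "{- (int i - 1), int i}"
      have w: "?w i = wsign {- (int i - 1)} {int i} *\<^sub>C bas ?A"
      proof -
        have "2 * int i \<noteq> 1" by presburger
        then show ?thesis
          by (simp add: emb_def alpha_vec_def beta_vec_def wedge_bas insert_commute)
      qed
      have "img_wedge g ?A (bas {}) = bas ?A"
        using fix_g[of i] that by (intro ext_map_fixed) (auto simp: alpha_vec_def beta_vec_def)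
      then show ?thesis unfolding w by (simp add: ext_map_def linext_scale)
    qed
    then have "ext_map g (sum ?w {N<..N'}) = sum ?w {N<..N'}"
      by (simp add: ext_map_def linext_sum)
    then show ?thesis unfolding s using eta by (simp add: ext_map_def linext_add)
  qed
  ultimately show "g \<in> carrier (Sp N')"
    using lin fix_g assms by (simp add: Sp_def)
qed

end

theory Submission
  imports Defs
begin

text \<open>
  The charges in the statement do not match at first sight: \<open>e\<^sub>a \<and> e\<^sub>b \<and> \<dots>\<close> in the power \<open>N - m\<close> of
  \<open>V\<^sub>N\<close> times the vacuum \<open>|-2N\<rangle>\<close> has charge \<open>-2m\<close>, and \<open>\<omega>\<close> lowers the charge while \<open>\<eta>\<^sub>N\<close> raises
  it.  The isomorphism is therefore a particle-hole exchange.  The symplectic form turns a vector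
  \<open>v\<close> into a contraction \<open>contr v\<close>, namely \<open>\<alpha>\<^sub>i \<mapsto> \<beta>\<^sub>i\<^sup>*\<close> and \<open>\<beta>\<^sub>i \<mapsto> - \<alpha>\<^sub>i\<^sup>*\<close>.  Contractions
  anticommute, so they make the exterior algebra act on the Fock space (\<open>contr_act_wedge\<close>), and
  acting on the vacuum \<open>|2N\<rangle>\<close> gives a map \<open>Phi N\<close> from the power \<open>N - m\<close> of \<open>V\<^sub>N\<close> to charge \<open>2m\<close>.

  These maps are injective, and their images exhaust the Fock space as \<open>N\<close> grows (\<open>Phi_inject\<close>,
  \<open>Phi_surj\<close>, \<open>fock_level_ex\<close>).  They are compatible with the transition maps, since
  \<open>contr \<alpha>\<^sub>N\<^sub>+\<^sub>1\<close> takes \<open>|2N+2\<rangle>\<close> to \<open>|2N\<rangle>\<close> (\<open>Phi_wedge_alphas\<close>).  As \<open>\<eta>\<^sub>N\<close> acts by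
  \<open>\<Sum> \<alpha>\<^sub>n\<^sup>*\<beta>\<^sub>n\<^sup>*\<close>, they take \<open>\<eta>\<^sub>N \<and> x\<close> to \<open>- \<omega> (Phi N x)\<close> (\<open>Phi_eta_level\<close>).  Hence the Fock space is
  the limit of the exterior powers and \<open>W\<^sub>2\<^sub>m\<close> is the limit of their quotients (\<open>lim_rel_iff\<close>).

  The remaining point is equivariance (\<open>fock_act_Phi\<close>).  An element \<open>g\<close> of \<open>Sp(2N)\<close> fixes the
  bivector \<open>\<eta>\<^sub>N\<close>, which is, up to sign, the inverse of the symplectic form,
  so \<open>g\<close> preserves the form (\<open>sform_invariant\<close>).  By the anticommutation relations \<open>g\<close> then carries \<open>contr v\<close> to
  \<open>contr (g v)\<close> (\<open>fock_act_contr\<close>).  It also fixes \<open>|2N\<rangle>\<close>, which is a nonzero multiple of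
  \<open>\<eta>\<^sub>N\<^sup>N \<and> |-2N\<rangle>\<close> (\<open>fock_act_vac\<close>); this is the fact that symplectic maps have
  determinant one.
\<close>

section \<open>Contractions by the symplectic form\<close>

text \<open>The Fock space and the finite exterior powers live in one type.  The anticommutation relations
  hold on its \<open>upper\<close> part only: for a set without upper bound \<open>n_above\<close> is the cardinality
  of a set that may be infinite, and no longer counts the sign.  \<open>finitary\<close> vectors form the
  exterior algebra of \<open>V\<^sub>\<infinity>\<close>.\<close>

definition upper :: "ext \<Rightarrow> bool"
  where "upper x \<longleftrightarrow> (\<forall>S\<in>keys x. bdd_above S)"

definition finitary :: "ext \<Rightarrow> bool"
  where "finitary x \<longleftrightarrow> (\<forall>S\<in>keys x. finite S)"

text \<open>The symplectic form is \<open>sform (e\<^sub>n) (e\<^sub>k) = eps n\<close> if \<open>k = 1 - n\<close> and \<open>0\<close> otherwise; the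
  reflection \<open>n \<mapsto> 1 - n\<close> exchanges the indices of \<open>\<alpha>\<^sub>i\<close> and \<open>\<beta>\<^sub>i\<close>.  The sign is such that
  \<open>sform \<alpha>\<^sub>i \<beta>\<^sub>i = 1\<close>.\<close>

definition eps :: "int \<Rightarrow> complex"
  where "eps n = (if n \<le> 0 then 1 else -1)"

text \<open>Contraction with the functional \<open>sform v\<close>.  Thus \<open>contr \<alpha>\<^sub>i = \<beta>\<^sub>i\<^sup>*\<close> and
  \<open>contr \<beta>\<^sub>i = - \<alpha>\<^sub>i\<^sup>*\<close>.\<close>

definition contr :: "vec \<Rightarrow> ext \<Rightarrow> ext"
  where "contr v x = linext (\<lambda>n. eps n *\<^sub>C psi (1 - n) x) v"

definition sform :: "vec \<Rightarrow> vec \<Rightarrow> complex"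
  where "sform v w = (\<Sum>n\<in>keys v. lookup v n * (eps n * lookup w (1 - n)))"

lemma finitary_upper [simp]: "finitary x \<Longrightarrow> upper x"
  by (simp add: finitary_def upper_def)

lemma upper_bas [simp]: "upper (bas S) = bdd_above S"
  by (simp add: upper_def)

lemma finitary_bas [simp]: "finitary (bas S) = finite S"
  by (simp add: finitary_def)

lemma keys_scale_ball: "\<forall>S\<in>keys x. P S \<Longrightarrow> \<forall>S\<in>keys (c *\<^sub>C x). P S"
  using keys_scale[of c x] by auto

lemma keys_linext_ball:
  assumes "\<And>a. a \<in> keys x \<Longrightarrow> \<forall>S\<in>keys (f a). P S"
  shows "\<forall>S\<in>keys (linext f x). P S"
  using keys_linext[of f x] assms by blast

lemma keys_sum_ball:
  assumes "\<And>i. i \<in> I \<Longrightarrow> \<forall>S\<in>keys (f i). P S"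
  shows "\<forall>S\<in>keys (sum f I). P S"
  using keys_sum[of f I] assms by blast

lemma sum_scale_left: "(\<Sum>i\<in>I. f i *\<^sub>C x) = (\<Sum>i\<in>I. f i) *\<^sub>C x"
  by (rule pm.scale_sum_left[symmetric])

lemma contr_bas: "contr (bas n) x = eps n *\<^sub>C psi (1 - n) x"
  by (simp add: contr_def)

lemma contr_lin: "contr v (x + y) = contr v x + contr v y" "contr v (c *\<^sub>C x) = c *\<^sub>C contr v x"
  "contr (v + w) x = contr v x + contr w x" "contr (c *\<^sub>C v) x = c *\<^sub>C contr v x"
  by (simp_all add: contr_def psi_lin linext_lin linext_fun_add pm.scale_right_distrib
      pm.scale_left_commute[of _ c] linext_fun_scale del: pm.scale_scale)

lemma contr_0 [simp]: "contr v 0 = 0" "contr 0 x = 0"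
  by (simp_all add: contr_def)

lemma vop_uminus: "vop v (- x) = - vop v x"
  using vop_lin(2)[of v "-1" x] by simp

lemma contr_linext_right: "contr v (linext f x) = linext (\<lambda>a. contr v (f a)) x"
  by (simp add: contr_def psi_linext linext_swap[of _ x] flip: linext_fun_scale)

lemma upper_contr [simp]: "upper x \<Longrightarrow> upper (contr v x)"
  unfolding contr_def upper_def
  by (intro keys_linext_ball keys_scale_ball bdd_psi)

lemma acomm_contr:
  assumes "upper x"
  shows "contr v (contr w x) = - contr w (contr v x)"
proof -
  let ?p = "\<lambda>n. psi (1 - n)"
  have e: "contr v (contr w x) = linext (\<lambda>n. linext (\<lambda>k. (eps n * eps k) *\<^sub>C ?p n (?p k x)) w) v" for v w
    by (simp add: contr_def psi_linext psi_lin linext_fun_scale flip: pm.scale_scale)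
  have "contr v (contr w x) + contr w (contr v x) =
     linext (\<lambda>n. linext (\<lambda>k. (eps n * eps k) *\<^sub>C (?p n (?p k x) + ?p k (?p n x))) w) v"
    unfolding e linext_swap[of _ v w]
    by (simp add: pm.scale_right_distrib linext_fun_add mult.commute)
  also have "\<dots> = 0" using assms by (simp add: acomm_psi upper_def)
  finally show ?thesis by (simp add: eq_neg_iff_add_eq_0)
qed

lemma contr_contr_self:
  assumes "upper x"
  shows "contr v (contr v x) = 0"
proof -
  have "contr v (contr v x) = - contr v (contr v x)" by (rule acomm_contr[OF assms])
  then have "2 *\<^sub>C contr v (contr v x) = 0"
    using pm.scale_left_distrib[of 1 1 "contr v (contr v x)"] by (simp add: eq_neg_iff_add_eq_0)
  then show ?thesis by simp
qed

lemma linext_delta: "linext (\<lambda>k. if k = c then f k else 0) w = lookup w c *\<^sub>C f c"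
proof -
  have "linext (\<lambda>k. if k = c then f k else 0) w = (\<Sum>k\<in>keys w. if k = c then lookup w k *\<^sub>C f k else 0)"
    unfolding linext_def by (intro sum.cong) auto
  then show ?thesis by (simp add: in_keys_iff)
qed

text \<open>The relation \<open>[\<psi>\<^sub>2\<^sub>k, \<psi>\<^sup>*\<^sub>2\<^sub>l]\<^sub>+ = \<delta>\<^sub>k\<^sub>l\<close> in a form that does not mention a basis.  It is
  what lets a linear map that preserves \<open>sform\<close> be pulled through contractions.\<close>

lemma contr_vop:
  assumes "upper x"
  shows "contr v (vop w x) = sform v w *\<^sub>C x - vop w (contr v x)"
proof -
  let ?p = "\<lambda>n. psi (1 - n)"
  have "contr v (vop w x) + vop w (contr v x) =
     linext (\<lambda>n. linext (\<lambda>k. eps n *\<^sub>C (?p n (psis k x) + psis k (?p n x))) w) v"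
    by (simp add: contr_def vop_linext psi_linext psis_linext psis_lin linext_swap[of _ w v]
        pm.scale_right_distrib linext_fun_add flip: linext_fun_scale)
  also have "\<dots> = linext (\<lambda>n. linext (\<lambda>k. if k = 1 - n then eps n *\<^sub>C x else 0) w) v"
    using assms by (intro linext_eqI) (auto simp: acomm_psi_psis upper_def)
  also have "\<dots> = linext (\<lambda>n. (eps n * lookup w (1 - n)) *\<^sub>C x) v"
    by (simp only: linext_delta pm.scale_scale mult.commute)
  also have "\<dots> = sform v w *\<^sub>C x"
    by (simp add: linext_def sform_def sum_scale_left)
  finally show ?thesis by (simp add: eq_diff_eq)
qed

lemma sform_superset: "finite I \<Longrightarrow> keys v \<subseteq> I \<Longrightarrow>
    sform v w = (\<Sum>n\<in>I. lookup v n * (eps n * lookup w (1 - n)))"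
  unfolding sform_def by (intro sum.mono_neutral_left) (auto simp: in_keys_iff)

lemma sform_bas: "sform (bas a) w = eps a * lookup w (1 - a)"
  by (simp add: sform_def) (simp add: bas_def)

lemma sform_linear_right: "sform v (w + w') = sform v w + sform v w'" "sform v (c *\<^sub>C w) = c * sform v w"
  by (simp_all add: sform_def lookup_add algebra_simps sum.distrib sum_distrib_left)

lemma sform_linear_left: "sform (v + v') w = sform v w + sform v' w" "sform (c *\<^sub>C v) w = c * sform v w"
proof -
  let ?I = "keys v \<union> keys v'"
  have "keys (v + v') \<subseteq> ?I" by (rule Poly_Mapping.keys_add)
  then show "sform (v + v') w = sform v w + sform v' w"
    by (subst (1 2 3) sform_superset[of ?I]) (auto simp: lookup_add algebra_simps sum.distrib)
  show "sform (c *\<^sub>C v) w = c * sform v w"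
    using keys_scale[of c v] by (subst sform_superset[of "keys v"]) (auto simp: sform_def sum_distrib_left ac_simps)
qed

section \<open>The exterior algebra acting by contractions\<close>

text \<open>The analogue of \<open>img_wedge\<close> with the operators \<open>contr e\<^sub>a\<close> in place of the creation operators
  \<open>vop (g e\<^sub>a)\<close>.  As contractions anticommute and square to zero, the product does not depend
  on the order of the factors except for the sign of the exterior algebra.\<close>

definition contr_wedge :: "int set \<Rightarrow> ext \<Rightarrow> ext"
  where "contr_wedge A z = foldr (\<lambda>a. contr (bas a)) (rev (sorted_list_of_set A)) z"

definition contr_act :: "ext \<Rightarrow> ext \<Rightarrow> ext"
  where "contr_act x z = linext (\<lambda>A. contr_wedge A z) x"

lemma contr_wedge_empty [simp]: "contr_wedge {} z = z" by (simp add: contr_wedge_def)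

lemma contr_wedge_insert_max:
  assumes "finite A" "\<forall>a\<in>A. a < b"
  shows "contr_wedge (insert b A) z = contr (bas b) (contr_wedge A z)"
  unfolding contr_wedge_def rev_sorted_insert_max[OF assms] by simp

lemma upper_contr_wedge [simp]: "upper z \<Longrightarrow> upper (contr_wedge A z)"
proof -
  have "upper z \<Longrightarrow> upper (foldr (\<lambda>a. contr (bas a)) as z)" for as
    by (induction as) auto
  then show "upper z \<Longrightarrow> upper (contr_wedge A z)" unfolding contr_wedge_def .
qed

lemma contr_wedge_lin: "contr_wedge A (x + y) = contr_wedge A x + contr_wedge A y"
  "contr_wedge A (c *\<^sub>C x) = c *\<^sub>C contr_wedge A x"
proof -
  have "foldr (\<lambda>a. contr (bas a)) as (x + y) = foldr (\<lambda>a. contr (bas a)) as x + foldr (\<lambda>a. contr (bas a)) as y"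
    "foldr (\<lambda>a. contr (bas a)) as (c *\<^sub>C x) = c *\<^sub>C foldr (\<lambda>a. contr (bas a)) as x" for as
    by (induction as) (auto simp: contr_lin)
  then show "contr_wedge A (x + y) = contr_wedge A x + contr_wedge A y"
    "contr_wedge A (c *\<^sub>C x) = c *\<^sub>C contr_wedge A x" unfolding contr_wedge_def by auto
qed

text \<open>The sign rule of \<open>psis_bas\<close>, for products of contractions: this makes the action below
  compatible with the exterior product.\<close>

lemma contr_wedge_insert:
  assumes "upper z" "finite A"
  shows "contr (bas n) (contr_wedge A z) =
    (if n \<in> A then 0 else (-1) ^ n_above n A *\<^sub>C contr_wedge (insert n A) z)"
  using assms(2)
proof (induction A rule: finite_linorder_max_induct)
  case empty
  show ?case using contr_wedge_insert_max[of "{}" n z] by (simp add: n_above_def)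
next
  case (insert b A)
  let ?I = "\<lambda>A. contr_wedge A z" and ?v = "\<lambda>n. contr (bas n)"
  have bd: "upper (?I A)" by (rule upper_contr_wedge[OF assms(1)])
  have eq: "?I (insert b A) = ?v b (?I A)" using insert.hyps by (intro contr_wedge_insert_max) auto
  have bA: "b \<notin> A" "bdd_above A" using insert.hyps by auto
  consider "n = b" | "b < n" | "n < b" by linarith
  then show ?case
  proof cases
    case 1 then show ?thesis using eq bd by (simp add: contr_contr_self)
  next
    case 2
    then have lt: "\<forall>a\<in>insert b A. a < n" using insert.hyps by auto
    then have "{s \<in> insert b A. n < s} = {}" by force
    then have "n_above n (insert b A) = 0" unfolding n_above_def by (metis card.empty)
    moreover have "n \<notin> insert b A" using lt by auto
    moreover have "finite (insert b A)" using insert.hyps by simp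
    ultimately show ?thesis using lt by (simp add: contr_wedge_insert_max[of "insert b A" n])
  next
    case 3
    have *: "?v n (?I (insert b A)) = - ?v b (?v n (?I A))" unfolding eq by (rule acomm_contr[OF bd])
    show ?thesis
    proof (cases "n \<in> A")
      case True then show ?thesis using * insert.IH by simp
    next
      case False
      have "?I (insert n (insert b A)) = ?v b (?I (insert n A))"
        using insert.hyps 3 by (subst insert_commute, intro contr_wedge_insert_max) auto
      then show ?thesis using * insert.IH False 3 bA
        by (simp add: contr_lin n_above_insert)
    qed
  qed
qed

lemma contr_act_lin: "contr_act (x + y) z = contr_act x z + contr_act y z" "contr_act (c *\<^sub>C x) z = c *\<^sub>C contr_act x z"
  "contr_act x (z + z') = contr_act x z + contr_act x z'" "contr_act x (c *\<^sub>C z) = c *\<^sub>C contr_act x z"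
  by (simp_all add: contr_act_def linext_lin contr_wedge_lin linext_fun_add linext_fun_scale)

lemma contr_act_0 [simp]: "contr_act 0 z = 0" by (simp add: contr_act_def)

lemma contr_act_uminus: "contr_act (- x) z = - contr_act x z"
  using contr_act_lin(2)[of "-1" x z] by simp

lemma contr_act_diff: "contr_act (x - y) z = contr_act x z - contr_act y z"
  using contr_act_lin(1)[of x "- y" z] by (simp add: contr_act_uminus)

lemma contr_act_bas: "contr_act (bas A) z = contr_wedge A z" by (simp add: contr_act_def)

lemma contr_act_linext: "contr_act (linext f x) z = linext (\<lambda>a. contr_act (f a) z) x"
  by (simp add: contr_act_def linext_linext)

lemma contr_act_sum: "contr_act (sum f I) z = (\<Sum>i\<in>I. contr_act (f i) z)"
  by (simp add: contr_act_def linext_sum)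

lemma upper_contr_act [simp]: "upper z \<Longrightarrow> upper (contr_act x z)"
  unfolding contr_act_def upper_def by (intro keys_linext_ball upper_contr_wedge[unfolded upper_def])

lemma contr_act_psis:
  assumes "upper z" "finitary x"
  shows "contr_act (psis n x) z = contr (bas n) (contr_act x z)"
proof -
  have "contr_act (psis n (bas A)) z = contr (bas n) (contr_act (bas A) z)" if "finite A" for A
    using that assms(1) by (simp add: psis_bas contr_act_lin contr_act_bas contr_wedge_insert)
  then have "linext (\<lambda>A. contr_act (psis n (bas A)) z) x = linext (\<lambda>A. contr (bas n) (contr_act (bas A) z)) x"
    using assms(2) by (intro linext_eqI) (auto simp: finitary_def)
  then have "contr_act (psis n (linext bas x)) z = contr (bas n) (contr_act (linext bas x) z)"
    by (simp only: psis_linext contr_act_linext contr_linext_right)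
  then show ?thesis by simp
qed

lemma contr_linext_left: "contr v x = linext (\<lambda>n. contr (bas n) x) v"
  by (simp add: contr_bas contr_def)

lemma contr_act_vop:
  assumes "upper z" "finitary x"
  shows "contr_act (vop v x) z = contr v (contr_act x z)"
  using assms by (subst contr_linext_left) (simp add: vop_linext contr_act_linext contr_act_psis)

lemma upper_vop [simp]: "upper x \<Longrightarrow> upper (vop v x)"
  unfolding upper_def by (rule bdd_vop)

lemma finitary_vop [simp]: "finitary x \<Longrightarrow> finitary (vop v x)"
  unfolding vop_linext finitary_def by (intro keys_linext_ball) (auto dest!: keys_psis)

lemma emb_vop: "emb v = vop v (bas {})"
  unfolding emb_def vop_linext by (intro linext_eqI) (simp add: psis_bas n_above_def)

lemma finitary_emb [simp]: "finitary (emb v)"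
  unfolding emb_vop by (intro finitary_vop) simp

lemma contr_act_emb: "upper z \<Longrightarrow> contr_act (emb v) z = contr v z"
  unfolding emb_vop by (simp add: contr_act_vop contr_act_bas)

lemma bas_insert_max:
  assumes "\<forall>a\<in>A. a < b"
  shows "bas (insert b A) = vop (bas b) (bas A)"
proof -
  have "{s \<in> A. b < s} = {}" using assms by force
  then have "n_above b A = 0" unfolding n_above_def by (metis card.empty)
  moreover have "b \<notin> A" using assms by auto
  ultimately show ?thesis by (simp add: vop_bas psis_bas)
qed

lemma keys_wedge: assumes "T \<in> keys (wedge x y)"
  shows "\<exists>A\<in>keys x. \<exists>B\<in>keys y. A \<inter> B = {} \<and> T = A \<union> B"
proof -
  let ?f = "\<lambda>A B. if A \<inter> B = {} then wsign A B *\<^sub>C bas (A \<union> B) else (0::ext)"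
  obtain A where A: "A \<in> keys x" "T \<in> keys (linext (?f A) y)"
    by (rule UN_E[OF subsetD[OF keys_linext assms[unfolded wedge_def]]])
  obtain B where B: "B \<in> keys y" "T \<in> keys (?f A B)"
    by (rule UN_E[OF subsetD[OF keys_linext A(2)]])
  have "A \<inter> B = {}" using B(2) by (auto split: if_splits)
  moreover from this B(2) have "T = A \<union> B" using keys_scale[of "wsign A B" "bas (A \<union> B)"] by auto
  ultimately show ?thesis using A B by blast
qed

lemma finitary_wedge [simp]: "finitary x \<Longrightarrow> finitary y \<Longrightarrow> finitary (wedge x y)"
  by (auto simp: finitary_def upper_def dest!: keys_wedge)

lemma upper_wedge [simp]: "upper x \<Longrightarrow> upper y \<Longrightarrow> upper (wedge x y)"
  by (auto simp: finitary_def upper_def dest!: keys_wedge)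

lemma wedge_vop:
  assumes "finitary x" "upper y"
  shows "wedge (vop v x) y = vop v (wedge x y)"
  unfolding vop_def using assms finitary_emb[of v]
  by (intro wedge_assoc) (auto simp: finitary_def upper_def)

lemma wedge_bas_empty [simp]: "wedge (bas {}) y = y"
  by (simp add: wedge_def)

text \<open>By the universal property of the exterior algebra, contractions extend from vectors to an
  action of the whole algebra.\<close>

lemma contr_act_wedge:
  assumes "finitary x" "finitary y" "upper z"
  shows "contr_act (wedge x y) z = contr_act x (contr_act y z)"
proof -
  have "contr_act (wedge (bas A) y) z = contr_act (bas A) (contr_act y z)" if "finite A" for A
    using that
  proof (induction A rule: finite_linorder_max_induct)
    case empty show ?case by (simp add: contr_act_bas)
  next
    case (insert b A)
    have "contr_act (wedge (bas (insert b A)) y) z = contr_act (vop (bas b) (wedge (bas A) y)) z"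
      unfolding bas_insert_max[OF insert.hyps(2)] using insert.hyps assms
      by (subst wedge_vop) auto
    also have "\<dots> = contr (bas b) (contr_act (wedge (bas A) y) z)"
      using insert.hyps assms by (intro contr_act_vop finitary_wedge) auto
    also have "\<dots> = contr_act (bas (insert b A)) (contr_act y z)"
      unfolding insert.IH using insert.hyps by (simp add: contr_act_bas contr_wedge_insert_max)
    finally show ?case .
  qed
  then have "linext (\<lambda>A. contr_act (wedge (bas A) y) z) x = linext (\<lambda>A. contr_act (bas A) (contr_act y z)) x"
    using assms by (intro linext_eqI) (auto simp: finitary_def)
  then have "contr_act (wedge (linext bas x) y) z = contr_act (linext bas x) (contr_act y z)"
    by (simp only: wedge_linext_left contr_act_linext)
  then show ?thesis by simp
qed

section \<open>The comparison of exterior powers with the Fock space\<close>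

lemma contr_alpha: "1 \<le> i \<Longrightarrow> contr (alpha_vec i) x = beta_star i x"
  by (simp add: alpha_vec_def contr_bas beta_star_def eps_def)

lemma contr_beta: "1 \<le> i \<Longrightarrow> contr (beta_vec i) x = - alpha_star i x"
  by (simp add: beta_vec_def contr_bas alpha_star_def eps_def)

lemma eta_vop: "eta N = (\<Sum>i = 1..N. vop (alpha_vec i) (vop (beta_vec i) (bas {})))"
  unfolding eta_def by (simp add: emb_vop[of "beta_vec _"] flip: vop_def)

lemma finitary_eta [simp]: "finitary (eta N)"
  unfolding eta_def finitary_def
  by (intro keys_sum_ball finitary_wedge[unfolded finitary_def] finitary_emb[unfolded finitary_def])

lemma wedge_sum_left: "wedge (sum f I) y = (\<Sum>i\<in>I. wedge (f i) y)"
  by (simp add: wedge_def linext_sum)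

lemma wedge_eta: "upper x \<Longrightarrow> wedge (eta N) x = (\<Sum>i = 1..N. vop (alpha_vec i) (vop (beta_vec i) x))"
  unfolding eta_vop wedge_sum_left
  by (intro sum.cong refl) (simp add: wedge_vop)

text \<open>On the image of the exterior powers \<open>\<eta>\<^sub>N\<close> acts as the first \<open>N\<close> terms of
  \<open>- \<omega> = \<Sum> \<alpha>\<^sub>n\<^sup>*\<beta>\<^sub>n\<^sup>*\<close>; the sign of \<open>contr \<beta>\<^sub>n = - \<alpha>\<^sub>n\<^sup>*\<close> cancels against the
  exchange of the two contractions.\<close>

lemma contr_act_eta:
  assumes "upper z"
  shows "contr_act (eta N) z = (\<Sum>i = 1..N. alpha_star i (beta_star i z))"
proof -
  have "contr_act (vop (alpha_vec i) (vop (beta_vec i) (bas {}))) z = alpha_star i (beta_star i z)"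
    if "i \<in> {1..N}" for i
  proof -
    have "contr_act (vop (alpha_vec i) (vop (beta_vec i) (bas {}))) z
        = contr (alpha_vec i) (contr (beta_vec i) z)"
      using assms by (simp add: contr_act_vop finitary_vop contr_act_bas)
    also have "\<dots> = - contr (beta_vec i) (contr (alpha_vec i) z)"
      by (rule acomm_contr[OF assms])
    finally show ?thesis using that by (simp add: contr_alpha contr_beta)
  qed
  then show ?thesis by (simp add: eta_vop contr_act_sum)
qed

text \<open>The operators \<open>\<beta>\<^sub>n\<^sup>*\<close> with \<open>n > N\<close> kill every vector without particles above \<open>N\<close>.\<close>

lemma omega_bounded:
  assumes "\<forall>S\<in>keys z. S \<subseteq> {..int N}"
  shows "omega z = - contr_act (eta N) z"
proof -
  have up: "upper z" using assms by (meson bdd_above_Iic bdd_above_mono upper_def)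
  have "beta_star n z = 0" if "N < n" for n
  proof -
    have "psi (int n) z = linext (\<lambda>_. 0) z"
      unfolding psi_def using assms that by (intro linext_eqI) fastforce
    then show ?thesis by (simp add: beta_star_def)
  qed
  then have "alpha_star n (beta_star n z) = 0" if "N < n" for n
    using that by (simp add: alpha_star_def)
  then have "{n. 1 \<le> n \<and> alpha_star n (beta_star n z) \<noteq> 0} \<subseteq> {1..N}"
    by (auto simp: not_less[symmetric])
  then have "omega z = - (\<Sum>i = 1..N. alpha_star i (beta_star i z))"
    unfolding omega_def by (intro arg_cong[of _ _ uminus] sum.mono_neutral_left) auto
  then show ?thesis using up by (simp add: contr_act_eta)
qed

text \<open>The part of the Fock space that is visible at stage \<open>N\<close>: everything below the window is
  occupied and everything above it is empty.\<close>

definition level :: "nat \<Rightarrow> int \<Rightarrow> ext set"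
  where "level N m = {z. \<forall>S\<in>keys z. S \<in> occupied m \<and> {..- int N} \<subseteq> S \<and> S \<subseteq> {..int N}}"

text \<open>The comparison map: a \<open>k\<close>-vector acts by contractions on the vacuum \<open>|2N\<rangle>\<close>, in which the
  whole window is occupied, and lowers the charge from \<open>2N\<close> to \<open>2(N - k)\<close>.  This is why the
  power \<open>N - m\<close> corresponds to charge \<open>2m\<close>.\<close>

abbreviation Phi :: "nat \<Rightarrow> ext \<Rightarrow> ext"
  where "Phi N x \<equiv> contr_act x (vac (int N))"

lemma level_fock: "z \<in> level N m \<Longrightarrow> z \<in> fock m"
  unfolding level_def fock_eq by auto

lemma level_mono: "z \<in> level N m \<Longrightarrow> N \<le> N' \<Longrightarrow> z \<in> level N' m"
  unfolding level_def by fastforce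

text \<open>A vector involves finitely many monomials, and each of them differs from \<open>{..0}\<close> in finitely
  many places.\<close>

lemma fock_level_ex:
  assumes "z \<in> fock m"
  shows "\<exists>N. z \<in> level N m"
proof -
  have "\<exists>N. \<forall>n\<ge>N. {..- int n} \<subseteq> S \<and> S \<subseteq> {..int n}" if S: "S \<in> occupied m" for S
  proof -
    have fin: "finite (S \<inter> {0<..})" "finite ({..0} - S)" using S by (auto simp: occupied_def)
    define U where "U = S \<inter> {0<..} \<union> uminus ` ({..0} - S)"
    have "finite U" using fin by (simp add: U_def)
    then obtain u where u: "\<forall>s\<in>U. s \<le> u" using bdd_above_finite[of U] by (auto simp: bdd_above_def)
    have "{..- int n} \<subseteq> S \<and> S \<subseteq> {..int n}" if "n \<ge> nat (u + 1)" for n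
    proof
      show "{..- int n} \<subseteq> S"
      proof
        fix s assume s: "s \<in> {..- int n}"
        show "s \<in> S"
        proof (rule ccontr)
          assume "s \<notin> S"
          then have "- s \<in> U" using s by (auto simp: U_def)
          then show False using u s that by fastforce
        qed
      qed
      show "S \<subseteq> {..int n}"
      proof
        fix s assume "s \<in> S"
        then have "s \<le> 0 \<or> s \<in> U" by (auto simp: U_def)
        then show "s \<in> {..int n}" using u that by fastforce
      qed
    qed
    then show ?thesis by blast
  qed
  moreover have "keys z \<subseteq> occupied m" using assms by (simp add: fock_eq)
  ultimately have "\<forall>S\<in>keys z. \<exists>N. \<forall>n\<ge>N. {..- int n} \<subseteq> S \<and> S \<subseteq> {..int n}" by blast
  then obtain f where f: "\<forall>S\<in>keys z. \<forall>n\<ge>f S. {..- int n} \<subseteq> S \<and> S \<subseteq> {..int n}" by metis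
  have "f S \<le> Max (insert 0 (f ` keys z))" if "S \<in> keys z" for S
    using that by (intro Max_ge) auto
  then have "z \<in> level (Max (insert 0 (f ` keys z))) m"
    using f \<open>keys z \<subseteq> occupied m\<close> unfolding level_def by blast
  then show ?thesis ..
qed

lemma upper_fock: assumes "z \<in> fock m" shows "upper z"
proof -
  obtain N where "z \<in> level N m" using fock_level_ex[OF assms] ..
  then have "\<forall>S\<in>keys z. S \<subseteq> {..int N}" by (simp add: level_def)
  then show ?thesis unfolding upper_def by (meson bdd_above_Iic bdd_above_mono)
qed

lemma upper_vac [simp]: "upper (vac n)"
  by (simp add: vac_def)

lemma wedge_ext_power:
  assumes "x \<in> ext_power N j" "y \<in> ext_power N k"
  shows "wedge x y \<in> ext_power N (j + k)"
  unfolding ext_power_def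
proof (intro CollectI ballI)
  fix S assume "S \<in> keys (wedge x y)"
  then obtain A B where *: "A \<in> keys x" "B \<in> keys y" "A \<inter> B = {}" "S = A \<union> B"
    using keys_wedge by blast
  then have "A \<subseteq> win N" "B \<subseteq> win N" "int (card A) = j" "int (card B) = k"
    using assms by (auto simp: ext_power_def)
  moreover from this have "finite A" "finite B" by (blast intro: finite_subset[OF _ finite_win])+
  ultimately show "S \<subseteq> win N \<and> int (card S) = j + k"
    unfolding *(4) using card_Un_disjoint[of A B] *(3) by simp
qed

lemma ext_power_finitary: "x \<in> ext_power N k \<Longrightarrow> finitary x"
  unfolding ext_power_def finitary_def by (blast intro: finite_subset[OF _ finite_win])

lemma win_mono: "N \<le> N' \<Longrightarrow> win N \<subseteq> win N'"
  by (auto simp: win_def)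

lemma ext_power_mono: "x \<in> ext_power N k \<Longrightarrow> N \<le> N' \<Longrightarrow> x \<in> ext_power N' k"
  unfolding ext_power_def using win_mono[of N N'] by blast

lemma emb_ext_power: "keys v \<subseteq> win N \<Longrightarrow> emb v \<in> ext_power N 1"
  unfolding ext_power_def emb_def using keys_linext[of "\<lambda>n. bas {n}" v] by auto

lemma ext_power_bas_empty: "bas {} \<in> ext_power N 0"
  by (simp add: ext_power_def)

lemma vop_ext_power: "keys v \<subseteq> win N \<Longrightarrow> x \<in> ext_power N k \<Longrightarrow> vop v x \<in> ext_power N (k + 1)"
  unfolding vop_def using wedge_ext_power[OF emb_ext_power, of v N x k] by (simp add: add.commute)

lemma keys_alpha_beta: "1 \<le> i \<Longrightarrow> i \<le> N \<Longrightarrow> keys (alpha_vec i) \<subseteq> win N"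
  "1 \<le> i \<Longrightarrow> i \<le> N \<Longrightarrow> keys (beta_vec i) \<subseteq> win N"
  by (auto simp: alpha_vec_def beta_vec_def win_def)

lemma subspace_keys: "pm.subspace {x. \<forall>S\<in>keys x. P S}"
  unfolding pm.subspace_def
  by (auto dest!: subsetD[OF Poly_Mapping.keys_add] subsetD[OF keys_scale])

lemma ext_power_subspace: "pm.subspace (ext_power N k)"
  unfolding ext_power_def by (rule subspace_keys)

lemma eta_ext_power: "eta N \<in> ext_power N 2"
  unfolding eta_def
proof (intro pm.subspace_sum[OF ext_power_subspace])
  fix i assume i: "i \<in> {1..N}"
  then show "wedge (emb (alpha_vec i)) (emb (beta_vec i)) \<in> ext_power N 2"
    using wedge_ext_power[OF emb_ext_power emb_ext_power, OF keys_alpha_beta(1)[of i] keys_alpha_beta(2)[of i]]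
    by simp
qed

text \<open>The set of occupied places after the contractions by \<open>e\<^sub>a\<close>, \<open>a \<in> A\<close>, have removed
  the particles at \<open>1 - a\<close> from \<open>|2N\<rangle>\<close>.\<close>

definition holes :: "nat \<Rightarrow> int set \<Rightarrow> int set"
  where "holes N A = {..int N} - (\<lambda>a. 1 - a) ` A"

lemma holes_holes:
  "A \<subseteq> win N \<Longrightarrow> (\<lambda>a. 1 - a) ` ({..int N} - holes N A) = A"
proof -
  assume "A \<subseteq> win N"
  then have "{..int N} - holes N A = (\<lambda>a. 1 - a) ` A" by (auto simp: holes_def win_def)
  then show ?thesis by (simp add: image_image)
qed

text \<open>Up to sign \<open>Phi N\<close> is the bijection \<open>holes N\<close> on basis vectors, a version of the Hodge star.
  The signs themselves never matter: compatibility with all structures comes from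
  \<open>contr_act_wedge\<close>.\<close>

lemma contr_wedge_vac:
  assumes "A \<subseteq> win N"
  shows "\<exists>c\<in>{1, -1}. contr_wedge A (vac (int N)) = c *\<^sub>C bas (holes N A)"
proof -
  have "finite A" using assms finite_win by (rule finite_subset)
  then show ?thesis using assms
  proof (induction A rule: finite_linorder_max_induct)
    case empty show ?case by (auto simp: holes_def vac_def)
  next
    case (insert b A)
    then have "\<exists>c\<in>{1, -1}. contr_wedge A (vac (int N)) = c *\<^sub>C bas (holes N A)" by simp
    then obtain c where c: "c \<in> {1, -1}" "contr_wedge A (vac (int N)) = c *\<^sub>C bas (holes N A)" ..
    \<comment> \<open>the new contraction meets an occupied place, so it does not give zero\<close>
    have "1 - b \<in> holes N A" "holes N A - {1 - b} = holes N (insert b A)"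
      using insert.hyps insert.prems by (auto simp: holes_def win_def)
    then have "contr_wedge (insert b A) (vac (int N)) =
        (c * (eps b * (-1) ^ n_above (1 - b) (holes N A))) *\<^sub>C bas (holes N (insert b A))"
      using insert.hyps by (simp add: contr_wedge_insert_max c contr_lin contr_bas psi_bas)
    moreover have "c * (eps b * (-1) ^ n_above (1 - b) (holes N A)) \<in> {1, -1}"
      using c(1) by (cases "even (n_above (1 - b) (holes N A))") (auto simp: eps_def)
    ultimately show ?case by blast
  qed
qed

lemma occupied_iff_card_holes:
  assumes "{..- int N} \<subseteq> S" "S \<subseteq> {..int N}"
  shows "S \<in> occupied m \<longleftrightarrow> int (card ({..int N} - S)) = int N - m"
proof -
  have sub: "S \<inter> {0<..} \<subseteq> {1..int N}" using assms(2) by auto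
  have "{..0} - S \<subseteq> {- int N..0}" using assms(1) by (auto simp: subset_eq)
  then have fin: "finite (S \<inter> {0<..})" "finite ({..0} - S)"
    using sub finite_subset by blast+
  have d: "{..int N} - S = ({..0} - S) \<union> ({1..int N} - S)" by auto
  have f: "finite ({1..int N} - S)" by simp
  have "card ({..int N} - S) = card ({..0} - S) + card ({1..int N} - S)"
    unfolding d by (rule card_Un_disjoint[OF fin(2) f]) auto
  moreover have "{1..int N} - S = {1..int N} - (S \<inter> {0<..})" by auto
  moreover have "card ({1..int N} - (S \<inter> {0<..})) = N - card (S \<inter> {0<..})"
    using card_Diff_subset[OF fin(1) sub] by simp
  moreover have "card (S \<inter> {0<..}) \<le> N"
    using card_mono[OF _ sub] by simp
  ultimately show ?thesis using fin by (auto simp: occupied_def)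
qed

lemma holes_level:
  assumes "A \<subseteq> win N" "int (card A) = int N - m"
  shows "bas (holes N A) \<in> level N m"
proof -
  have sub: "{..- int N} \<subseteq> holes N A" "holes N A \<subseteq> {..int N}"
    using assms(1) by (auto simp: holes_def win_def)
  have "{..int N} - holes N A = (\<lambda>a. 1 - a) ` A" using assms(1) by (auto simp: holes_def win_def)
  moreover have "inj_on (\<lambda>a. 1 - a :: int) A" by (simp add: inj_on_def)
  ultimately have "int (card ({..int N} - holes N A)) = int N - m"
    using assms by (simp add: card_image)
  then show ?thesis using occupied_iff_card_holes[OF sub] sub by (simp add: level_def)
qed

lemma level_subspace: "pm.subspace (level N k)"
  unfolding level_def by (rule subspace_keys)

lemma linext_subspace: "pm.subspace U \<Longrightarrow> (\<And>a. a \<in> keys x \<Longrightarrow> f a \<in> U) \<Longrightarrow> linext f x \<in> U"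
  unfolding linext_def by (intro pm.subspace_sum pm.subspace_scale)

text \<open>Together with the next two lemmas: \<open>Phi N\<close> identifies the exterior power with a level of the
  Fock space.\<close>

lemma Phi_level:
  assumes "x \<in> ext_power N (int N - m)"
  shows "Phi N x \<in> level N m"
  unfolding contr_act_def
proof (rule linext_subspace[OF level_subspace])
  fix A assume "A \<in> keys x"
  then have A: "A \<subseteq> win N" "int (card A) = int N - m" using assms by (auto simp: ext_power_def)
  obtain c where "contr_wedge A (vac (int N)) = c *\<^sub>C bas (holes N A)"
    using contr_wedge_vac[OF A(1)] by blast
  then show "contr_wedge A (vac (int N)) \<in> level N m"
    using holes_level[OF A] by (simp add: pm.subspace_scale[OF level_subspace])
qed

lemma Phi_inject:
  assumes "\<forall>A\<in>keys x. A \<subseteq> win N" "Phi N x = 0"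
  shows "x = 0"
proof -
  have "\<exists>c. c \<noteq> 0 \<and> contr_wedge A (vac (int N)) = c *\<^sub>C bas (holes N A)" if "A \<subseteq> win N" for A
    using contr_wedge_vac[OF that] by (metis empty_iff insert_iff neg_equal_0_iff_equal zero_neq_one)
  then obtain c where c: "\<And>A. A \<subseteq> win N \<Longrightarrow> c A \<noteq> 0"
    "\<And>A. A \<subseteq> win N \<Longrightarrow> contr_wedge A (vac (int N)) = c A *\<^sub>C bas (holes N A)" by metis
  have "lookup x A = 0" if A: "A \<in> keys x" for A
  proof -
    have "lookup (Phi N x) (holes N A) =
        (\<Sum>B\<in>keys x. lookup x B * (lookup (contr_wedge B (vac (int N))) (holes N A)))"
      by (simp add: contr_act_def linext_def lookup_sum)
    also have "\<dots> = (\<Sum>B\<in>keys x. if B = A then lookup x A * c A else 0)"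
    proof (rule sum.cong[OF refl])
      fix B assume B: "B \<in> keys x"
      have "holes N B = holes N A \<longleftrightarrow> B = A" using holes_holes assms(1) A B by metis
      then show "lookup x B * (lookup (contr_wedge B (vac (int N))) (holes N A)) =
          (if B = A then lookup x A * c A else 0)"
        using c assms(1) B by (auto simp: bas_def lookup_single when_def)
    qed
    finally show ?thesis using assms A c(1) by (auto simp: in_keys_iff)
  qed
  then show ?thesis by (intro poly_mapping_eqI) (metis in_keys_iff lookup_zero)
qed

lemma Phi_surj:
  assumes "z \<in> level N m"
  obtains x where "x \<in> ext_power N (int N - m)" "Phi N x = z"
proof -
  have "\<exists>x\<in>ext_power N (int N - m). Phi N x = bas S" if "S \<in> keys z" for S
  proof -
    have S: "S \<in> occupied m" "{..- int N} \<subseteq> S" "S \<subseteq> {..int N}"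
      using assms that by (auto simp: level_def)
    define A where "A = (\<lambda>a. 1 - a) ` ({..int N} - S)"
    have "1 - s \<in> win N" if s: "s \<in> {..int N} - S" for s
    proof -
      have "s \<notin> {..- int N}" using S(2) s by blast
      then show ?thesis using s by (auto simp: win_def)
    qed
    then have A: "A \<subseteq> win N" unfolding A_def by (rule image_subsetI)
    have "inj_on (\<lambda>a. 1 - a :: int) ({..int N} - S)" by (simp add: inj_on_def)
    then have "int (card A) = int N - m"
      using S occupied_iff_card_holes[of N S m] by (simp add: A_def card_image)
    have "holes N A = S" using S by (auto simp: holes_def A_def image_iff)
    moreover obtain c where c: "c \<in> {1, -1}" "contr_wedge A (vac (int N)) = c *\<^sub>C bas (holes N A)"
      using contr_wedge_vac[OF A] by blast
    ultimately have "Phi N (c *\<^sub>C bas A) = bas S"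
      by (auto simp: contr_act_lin contr_act_bas)
    moreover have "c *\<^sub>C bas A \<in> ext_power N (int N - m)"
      by (rule pm.subspace_scale[OF ext_power_subspace])
        (use A \<open>int (card A) = int N - m\<close> in \<open>simp add: ext_power_def\<close>)
    ultimately show ?thesis by blast
  qed
  then obtain f where f: "\<And>S. S \<in> keys z \<Longrightarrow> f S \<in> ext_power N (int N - m)"
    "\<And>S. S \<in> keys z \<Longrightarrow> Phi N (f S) = bas S" by metis
  have "Phi N (linext f z) = linext bas z"
    unfolding contr_act_linext using f(2) by (intro linext_eqI)
  moreover have "linext f z \<in> ext_power N (int N - m)"
    using f(1) by (intro linext_subspace[OF ext_power_subspace])
  ultimately show ?thesis using that by simp
qed

lemma Phi_eta:
  assumes "finitary x" "\<forall>S\<in>keys (Phi N x). S \<subseteq> {..int N}"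
  shows "Phi N (wedge (eta N) x) = - omega (Phi N x)"
  using assms by (simp add: contr_act_wedge finitary_eta omega_bounded)

text \<open>The transition maps append \<open>\<alpha>\<^sub>N\<^sub>+\<^sub>1\<close>, whose contraction takes the vacuum of one
  stage to the vacuum of the stage before.  Hence the maps \<open>Phi N\<close> fit together.\<close>

lemma contr_alpha_vac: "contr (alpha_vec (Suc N)) (vac (int (Suc N))) = vac (int N)"
proof -
  have "{s \<in> {..int (Suc N)}. int (Suc N) < s} = {}" by auto
  then have "n_above (int (Suc N)) {..int (Suc N)} = 0" unfolding n_above_def by (metis card.empty)
  moreover have "{..int (Suc N)} - {int (Suc N)} = {..int N}" by auto
  ultimately show ?thesis
    by (simp add: contr_alpha beta_star_def vac_def psi_bas del: of_nat_Suc)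
qed

lemma wedge_alphas_refl: "wedge_alphas N N x = x"
  by (simp add: wedge_alphas_def)

lemma wedge_alphas_Suc:
  "N \<le> N' \<Longrightarrow> wedge_alphas N (Suc N') x = wedge (wedge_alphas N N' x) (emb (alpha_vec (Suc N')))"
  by (simp add: wedge_alphas_def)

lemma wedge_alphas_ext_power:
  assumes "x \<in> ext_power N (int N - k)" "N \<le> N'"
  shows "wedge_alphas N N' x \<in> ext_power N' (int N' - k)"
  using assms(2)
proof (induction N' rule: dec_induct)
  case base show ?case using assms(1) by (simp add: wedge_alphas_refl)
next
  case (step N')
  have "wedge (wedge_alphas N N' x) (emb (alpha_vec (Suc N'))) \<in> ext_power (Suc N') (int N' - k + 1)"
    using step.IH by (intro wedge_ext_power emb_ext_power keys_alpha_beta)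
      (auto intro: ext_power_mono)
  then show ?case using step.hyps by (simp add: wedge_alphas_Suc algebra_simps)
qed

lemma Phi_wedge_alphas:
  assumes "finitary x" "N \<le> N'"
  shows "finitary (wedge_alphas N N' x) \<and> Phi N' (wedge_alphas N N' x) = Phi N x"
  using assms(2)
proof (induction N' rule: dec_induct)
  case base show ?case using assms(1) by (simp add: wedge_alphas_refl)
next
  case (step N')
  then show ?case
    by (simp add: wedge_alphas_Suc contr_act_wedge finitary_emb finitary_wedge contr_act_emb contr_alpha_vac
        del: of_nat_Suc)
qed

lemma wedge_alphas_lin:
  "wedge_alphas N N' (x + y) = wedge_alphas N N' x + wedge_alphas N N' y"
  "wedge_alphas N N' (c *\<^sub>C x) = c *\<^sub>C wedge_alphas N N' x"
proof -
  have "foldl (\<lambda>x i. wedge x (emb (alpha_vec i))) (x + y) is =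
      foldl (\<lambda>x i. wedge x (emb (alpha_vec i))) x is + foldl (\<lambda>x i. wedge x (emb (alpha_vec i))) y is"
    "foldl (\<lambda>x i. wedge x (emb (alpha_vec i))) (c *\<^sub>C x) is =
      c *\<^sub>C foldl (\<lambda>x i. wedge x (emb (alpha_vec i))) x is" for "is" x y
    by (induction "is" arbitrary: x y) (auto simp: wedge_add_left wedge_scale_left)
  then show "wedge_alphas N N' (x + y) = wedge_alphas N N' x + wedge_alphas N N' y"
    "wedge_alphas N N' (c *\<^sub>C x) = c *\<^sub>C wedge_alphas N N' x"
    unfolding wedge_alphas_def by auto
qed

section \<open>The action of linear maps\<close>

lemma linear_on_upper_eqI:
  assumes "Vector_Spaces.linear cscale cscale G" "Vector_Spaces.linear cscale cscale H"
    and "\<And>S. bdd_above S \<Longrightarrow> G (bas S) = H (bas S)" and "upper x"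
  shows "G x = H x"
  unfolding linear_linext_expand[OF assms(1), of x] linear_linext_expand[OF assms(2), of x]
  using assms(3,4) by (intro linext_eqI) (auto simp: upper_def)

lemma linearI: "(\<And>x y. G (x + y) = G x + G y) \<Longrightarrow> (\<And>c x. G (c *\<^sub>C x) = c *\<^sub>C G x) \<Longrightarrow>
    Vector_Spaces.linear cscale cscale G"
  unfolding Vector_Spaces.linear_iff by (auto simp: pm.vector_space_axioms)

text \<open>A monomial is built from one without factors in \<open>V\<^sub>N\<close> by inserting factors from the window,
  which is how the action of \<open>Sp(2N)\<close> is defined.\<close>

lemma window_induct [consumes 1, case_names outside insert]:
  assumes "bdd_above S"
    and base: "\<And>B. bdd_above B \<Longrightarrow> B \<inter> win N = {} \<Longrightarrow> P B"
    and step: "\<And>n S. n \<in> win N \<Longrightarrow> n \<notin> S \<Longrightarrow> bdd_above S \<Longrightarrow> P S \<Longrightarrow> P (insert n S)"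
  shows "P S"
proof -
  let ?B = "S - win N"
  have B: "bdd_above ?B" using assms(1) by (rule bdd_above_mono) auto
  have "P (A \<union> ?B)" if "finite A" "A \<subseteq> win N" for A
    using that
  proof (induction A)
    case empty show ?case using base[OF B] by auto
  next
    case (insert a A)
    have "P (insert a (A \<union> ?B))" using insert B by (intro step) auto
    then show ?case by simp
  qed
  from this[of "S \<inter> win N"] show ?thesis by (simp add: Int_Diff_Un)
qed

lemma bas_insert:
  assumes "n \<notin> S"
  shows "bas (insert n S) = (-1) ^ n_above n S *\<^sub>C vop (bas n) (bas S)"
  using assms by (simp add: vop_bas psis_bas flip: power_add mult_2)

lemma ext_map_lin: "ext_map g (x + y) = ext_map g x + ext_map g y"
  "ext_map g (c *\<^sub>C x) = c *\<^sub>C ext_map g x"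
  by (simp_all add: ext_map_def linext_lin)

lemma ext_map_sum: "ext_map g (sum f I) = (\<Sum>i\<in>I. ext_map g (f i))"
  by (simp add: ext_map_def linext_sum)

lemma ext_map_linext: "ext_map g (linext f x) = linext (\<lambda>a. ext_map g (f a)) x"
  by (simp add: ext_map_def linext_linext)

lemma ext_map_empty [simp]: "ext_map g (bas {}) = bas {}"
  by (simp add: ext_map_def)

lemma finitary_img_wedge: "finitary z \<Longrightarrow> finitary (img_wedge g A z)"
proof -
  have "finitary z \<Longrightarrow> finitary (foldr (\<lambda>a. vop (g (bas a))) as z)" for as
    by (induction as) auto
  then show "finitary z \<Longrightarrow> finitary (img_wedge g A z)" unfolding img_wedge_def .
qed

lemma upper_img_wedge: "upper z \<Longrightarrow> upper (img_wedge g A z)"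
proof -
  have "upper z \<Longrightarrow> upper (foldr (\<lambda>a. vop (g (bas a))) as z)" for as
    by (induction as) auto
  then show "upper z \<Longrightarrow> upper (img_wedge g A z)" unfolding img_wedge_def .
qed

lemma finitary_ext_map [simp]: "finitary (ext_map g x)"
  unfolding ext_map_def finitary_def
  by (intro keys_linext_ball finitary_img_wedge[unfolded finitary_def]) simp

lemma ext_map_psis:
  assumes "finitary x"
  shows "ext_map g (psis n x) = vop (g (bas n)) (ext_map g x)"
proof -
  have "ext_map g (psis n (bas A)) = vop (g (bas n)) (ext_map g (bas A))" if "finite A" for A
    using that img_wedge_insert[of "bas {}" A g n]
    by (simp add: psis_bas ext_map_lin ext_map_def linext_lin)
  then have "linext (\<lambda>A. ext_map g (psis n (bas A))) x = linext (\<lambda>A. vop (g (bas n)) (ext_map g (bas A))) x"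
    using assms by (intro linext_eqI) (auto simp: finitary_def)
  then have "ext_map g (psis n (linext bas x)) = vop (g (bas n)) (ext_map g (linext bas x))"
    by (simp only: psis_linext ext_map_linext vop_linext_right)
  then show ?thesis by simp
qed

lemma ext_map_vop:
  assumes "Vector_Spaces.linear cscale cscale g" "finitary x"
  shows "ext_map g (vop v x) = vop (g v) (ext_map g x)"
proof -
  have "ext_map g (vop v x) = linext (\<lambda>n. vop (g (bas n)) (ext_map g x)) v"
    using assms(2) by (simp add: vop_linext[of v] ext_map_linext ext_map_psis)
  also have "\<dots> = vop (g v) (ext_map g x)"
    by (subst linear_linext_expand[OF assms(1), of v]) (simp add: vop_linext linext_linext)
  finally show ?thesis .
qed

text \<open>For wedges of vectors of \<open>V\<^sub>N\<close> the two actions have the same formula, so facts about the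
  action on the Fock space specialise to the exterior algebra.\<close>

lemma fock_act_finite:
  assumes "\<forall>A\<in>keys x. A \<subseteq> win N"
  shows "fock_act N g x = ext_map g x"
  unfolding fock_act_def ext_map_def using assms
  by (intro linext_eqI) (simp add: Int_absorb2 Diff_eq_empty_iff[THEN iffD2])

lemma upper_fock_act [simp]:
  assumes "upper x"
  shows "upper (fock_act N g x)"
  unfolding fock_act_def
proof (unfold upper_def, intro keys_linext_ball keys_scale_ball)
  fix S assume "S \<in> keys x"
  then have "bdd_above S" using assms by (simp add: upper_def)
  then have "bdd_above (S - win N)" by (rule bdd_above_mono) auto
  then show "\<forall>T\<in>keys (img_wedge g (S \<inter> win N) (bas (S - win N))). bdd_above T"
    using upper_img_wedge[of "bas (S - win N)"] by (simp add: upper_def)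
qed

lemma fock_act_outside: "S \<inter> win N = {} \<Longrightarrow> fock_act N g (bas S) = bas S"
  by (simp add: fock_act_bas Diff_triv)

lemma bas_in_V: assumes "a \<in> win N" shows "bas a \<in> V N"
proof -
  have "bas a \<in> alpha_vec ` {1..N} \<union> beta_vec ` {1..N}"
  proof (cases "a \<le> 0")
    case True
    then have "bas a = alpha_vec (nat (1 - a))" "nat (1 - a) \<in> {1..N}"
      using assms by (auto simp: alpha_vec_def win_def)
    then show ?thesis by blast
  next
    case False
    then have "bas a = beta_vec (nat a)" "nat a \<in> {1..N}"
      using assms by (auto simp: beta_vec_def win_def)
    then show ?thesis by blast
  qed
  then show ?thesis unfolding V_def by (rule pm.span_base)
qed

lemma alpha_beta_V: "i \<in> {1..N} \<Longrightarrow> alpha_vec i \<in> V N" "i \<in> {1..N} \<Longrightarrow> beta_vec i \<in> V N"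
  unfolding V_def by (auto intro!: pm.span_base)

lemma V_induct [consumes 1, case_names zero alpha beta]:
  assumes "v \<in> V N" "P 0"
    and "\<And>c i v. i \<in> {1..N} \<Longrightarrow> P v \<Longrightarrow> P (c *\<^sub>C alpha_vec i + v)"
    and "\<And>c i v. i \<in> {1..N} \<Longrightarrow> P v \<Longrightarrow> P (c *\<^sub>C beta_vec i + v)"
  shows "P v"
  using assms(1) unfolding V_def
  by (induction rule: pm.span_induct_alt) (use assms in auto)

lemma SpD:
  assumes "g \<in> carrier (Sp N)"
  shows "Vector_Spaces.linear cscale cscale g" "bij_betw g (V N) (V N)"
    "\<And>a. a \<notin> win N \<Longrightarrow> g (bas a) = bas a" "ext_map g (eta N) = eta N"
    "\<And>v. v \<in> V N \<Longrightarrow> g v \<in> V N"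
proof -
  show "Vector_Spaces.linear cscale cscale g" "bij_betw g (V N) (V N)" "ext_map g (eta N) = eta N"
    using assms by (auto simp: Sp_def)
  then show "\<And>v. v \<in> V N \<Longrightarrow> g v \<in> V N" by (auto simp: bij_betw_def)
  fix a assume a: "a \<notin> win N"
  have f: "\<And>i. N < i \<Longrightarrow> g (alpha_vec i) = alpha_vec i \<and> g (beta_vec i) = beta_vec i"
    using assms by (auto simp: Sp_def)
  show "g (bas a) = bas a"
  proof (cases "a \<le> 0")
    case True
    then have "bas a = alpha_vec (nat (1 - a))" "N < nat (1 - a)"
      using a by (auto simp: alpha_vec_def win_def)
    then show ?thesis using f by metis
  next
    case False
    then have "bas a = beta_vec (nat a)" "N < nat a"
      using a by (auto simp: beta_vec_def win_def)
    then show ?thesis using f by metis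
  qed
qed

section \<open>Invariance of the symplectic form\<close>

lemma emb_lin: "emb (v + w) = emb v + emb w" "emb (c *\<^sub>C v) = c *\<^sub>C emb v"
  by (simp_all add: emb_def linext_lin)

lemma emb_sum: "emb (sum f I) = (\<Sum>i\<in>I. emb (f i))"
  by (simp add: emb_def linext_sum)

lemma emb_diff: "emb (v - w) = emb v - emb w"
  using emb_lin(1)[of v "- w"] emb_lin(2)[of "-1" w] by simp

lemma lookup_emb: "lookup (emb v) {n} = lookup v n"
proof -
  have "lookup (emb v) {n} = (\<Sum>a\<in>keys v. if a = n then lookup v a else 0)"
    by (simp add: emb_def linext_def lookup_sum bas_def lookup_single when_def if_distrib[of "(*) _"] cong: if_cong)
  then show ?thesis by (simp add: in_keys_iff)
qed

lemma emb_inject: "emb v = emb w \<Longrightarrow> v = w"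
  by (intro poly_mapping_eqI) (metis lookup_emb)

lemma contr_empty [simp]: "contr v (bas {}) = 0"
  by (simp add: contr_def psi_bas)

lemma contr_sum_right: "contr v (sum f I) = (\<Sum>i\<in>I. contr v (f i))"
  by (induction I rule: infinite_finite_induct) (auto simp: contr_lin)

lemma contr_wedge_vectors:
  "contr v (vop u (vop w (bas {}))) = emb (sform v u *\<^sub>C w - sform v w *\<^sub>C u)"
  unfolding emb_diff emb_lin by (simp add: contr_vop vop_lin emb_vop)

lemma sform_basis:
  assumes "i \<in> {1..N}" "j \<in> {1..N}"
  shows "sform (alpha_vec i) (alpha_vec j) = 0" "sform (beta_vec i) (beta_vec j) = 0"
    "sform (alpha_vec i) (beta_vec j) = (if i = j then 1 else 0)"
    "sform (beta_vec i) (alpha_vec j) = (if i = j then -1 else 0)"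
  using assms by (auto simp: sform_bas alpha_vec_def beta_vec_def)
    (auto simp: bas_def lookup_single when_def eps_def)

lemma sform_zero [simp]: "sform v 0 = 0" "sform 0 v = 0"
  by (simp_all add: sform_def)

text \<open>The contraction of \<open>\<eta>\<^sub>N\<close> with a functional \<open>f\<close> on \<open>V\<^sub>N\<close>.\<close>

definition eta_contract :: "nat \<Rightarrow> (vec \<Rightarrow> complex) \<Rightarrow> vec"
  where "eta_contract N f = (\<Sum>i = 1..N. f (alpha_vec i) *\<^sub>C beta_vec i - f (beta_vec i) *\<^sub>C alpha_vec i)"

lemma eta_contract_linear: "eta_contract N (\<lambda>w. c * f w + h w) = c *\<^sub>C eta_contract N f + eta_contract N h"
  unfolding eta_contract_def pm.scale_sum_right sum.distrib[symmetric]
  by (intro sum.cong refl) (simp add: algebra_simps pm.scale_left_distrib pm.scale_right_diff_distrib)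

text \<open>\<open>\<eta>\<^sub>N\<close> as a map from functionals to vectors is inverse, up to sign, to \<open>v \<mapsto> sform v\<close>;
  so a linear map that preserves the bivector also preserves the form.\<close>

lemma eta_contract_sform:
  assumes "v \<in> V N"
  shows "eta_contract N (sform v) = - v"
  using assms
proof (induction rule: V_induct)
  case zero show ?case by (simp add: eta_contract_def)
next
  case (alpha c i v)
  have "eta_contract N (sform (alpha_vec i)) = (\<Sum>j = 1..N. if j = i then - alpha_vec i else 0)"
    unfolding eta_contract_def using alpha(1) by (intro sum.cong refl) (auto simp: sform_basis[of i N])
  then have "eta_contract N (sform (alpha_vec i)) = - alpha_vec i" using alpha(1) by simp
  moreover have "sform (c *\<^sub>C alpha_vec i + v) = (\<lambda>w. c * sform (alpha_vec i) w + sform v w)"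
    by (simp add: fun_eq_iff sform_linear_left)
  ultimately show ?case using alpha by (simp add: eta_contract_linear)
next
  case (beta c i v)
  have "eta_contract N (sform (beta_vec i)) = (\<Sum>j = 1..N. if j = i then - beta_vec i else 0)"
    unfolding eta_contract_def using beta(1) by (intro sum.cong refl) (auto simp: sform_basis[of i N])
  then have "eta_contract N (sform (beta_vec i)) = - beta_vec i" using beta(1) by simp
  moreover have "sform (c *\<^sub>C beta_vec i + v) = (\<lambda>w. c * sform (beta_vec i) w + sform v w)"
    by (simp add: fun_eq_iff sform_linear_left)
  ultimately show ?case using beta by (simp add: eta_contract_linear)
qed

lemma eta_contract_inject:
  assumes "eta_contract N f = eta_contract N h" "i \<in> {1..N}"
  shows "f (alpha_vec i) = h (alpha_vec i)" "f (beta_vec i) = h (beta_vec i)"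
proof -
  have s: "sform (alpha_vec i) (sum f I) = (\<Sum>j\<in>I. sform (alpha_vec i) (f j))" 
    "sform (beta_vec i) (sum f I) = (\<Sum>j\<in>I. sform (beta_vec i) (f j))" for f :: "nat \<Rightarrow> vec" and I
    by (induction I rule: infinite_finite_induct) (auto simp: sform_linear_right)
  have d: "sform v (w - w') = sform v w - sform v w'" for v w w'
    using sform_linear_right(1)[of v w "- w'"] sform_linear_right(2)[of v "-1" w'] by simp
  have "sform (alpha_vec i) (eta_contract N f) = (\<Sum>j = 1..N. if j = i then f (alpha_vec i) else 0)" for f
    unfolding eta_contract_def s using assms(2)
    by (intro sum.cong refl) (auto simp: sform_basis[of i N] d sform_linear_right)
  then have a: "sform (alpha_vec i) (eta_contract N f) = f (alpha_vec i)" for f using assms(2) by simp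
  have "sform (beta_vec i) (eta_contract N f) = (\<Sum>j = 1..N. if j = i then f (beta_vec i) else 0)" for f
    unfolding eta_contract_def s using assms(2)
    by (intro sum.cong refl) (auto simp: sform_basis[of i N] d sform_linear_right)
  then have b: "sform (beta_vec i) (eta_contract N f) = f (beta_vec i)" for f using assms(2) by simp
  show "f (alpha_vec i) = h (alpha_vec i)" "f (beta_vec i) = h (beta_vec i)"
    using a b assms(1) by metis+
qed

lemma contr_eta: "contr v (eta N) = emb (eta_contract N (sform v))"
  by (simp add: eta_vop contr_sum_right contr_wedge_vectors eta_contract_def emb_sum)

lemma Sp_eta_vop:
  assumes "g \<in> carrier (Sp N)"
  shows "eta N = (\<Sum>i = 1..N. vop (g (alpha_vec i)) (vop (g (beta_vec i)) (bas {})))"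
proof -
  have "eta N = ext_map g (eta N)" using SpD(4)[OF assms] by simp
  also have "\<dots> = (\<Sum>i = 1..N. vop (g (alpha_vec i)) (vop (g (beta_vec i)) (bas {})))"
    unfolding eta_vop ext_map_sum using SpD(1)[OF assms] by (simp add: ext_map_vop)
  finally show ?thesis .
qed

text \<open>Contract \<open>\<eta>\<^sub>N = \<Sum> g \<alpha>\<^sub>i \<and> g \<beta>\<^sub>i\<close> with \<open>g v\<close>.  By \<open>eta_contract_sform\<close> the result is
  \<open>- g v\<close>; removing \<open>g\<close> leaves the coefficients \<open>sform (g v) (g \<alpha>\<^sub>i)\<close> and
  \<open>sform (g v) (g \<beta>\<^sub>i)\<close> determined by \<open>v\<close>.\<close>

lemma sform_invariant:
  assumes g: "g \<in> carrier (Sp N)" and v: "v \<in> V N" and w: "w \<in> V N"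
  shows "sform (g v) (g w) = sform v w"
proof -
  interpret g: Vector_Spaces.linear cscale cscale g by (rule SpD(1)[OF g])
  \<comment> \<open>the contraction of \<open>\<eta>\<^sub>N\<close> with \<open>g v\<close>, pulled back along \<open>g\<close>\<close>
  let ?r = "eta_contract N (\<lambda>w. sform (g v) (g w))"
  have "contr (g v) (eta N) = emb (g ?r)"
    unfolding Sp_eta_vop[OF g]
    by (simp add: contr_sum_right contr_wedge_vectors eta_contract_def emb_sum g.sum g.diff g.scale)
  moreover have "contr (g v) (eta N) = emb (- g v)"
    using eta_contract_sform[OF SpD(5)[OF g v]] by (simp add: contr_eta)
  ultimately have "g ?r = g (- v)" by (auto dest: emb_inject simp: g.neg)
  moreover have "?r \<in> V N" "- v \<in> V N"
    using v alpha_beta_V unfolding eta_contract_def V_def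
    by (auto intro!: pm.span_sum pm.span_diff pm.span_scale pm.span_neg)
  ultimately have "?r = - v" using SpD(2)[OF g] by (auto simp: bij_betw_def dest: inj_onD)
  also have "- v = eta_contract N (sform v)" by (rule eta_contract_sform[OF v, symmetric])
  finally have r: "?r = eta_contract N (sform v)" .
  show ?thesis
    using w eta_contract_inject[OF r]
    by (induction rule: V_induct) (auto simp: g.add g.scale g.zero sform_linear_right)
qed

section \<open>Invariance of the vacuum under the symplectic group\<close>

lemma fock_act_eta:
  assumes g: "g \<in> carrier (Sp N)" and x: "upper x"
  shows "fock_act N g (wedge (eta N) x) = wedge (eta N) (fock_act N g x)"
proof -
  have "fock_act N g (wedge (eta N) x) =
      (\<Sum>i = 1..N. vop (g (alpha_vec i)) (vop (g (beta_vec i)) (fock_act N g x)))"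
    unfolding wedge_eta[OF x] fock_act_def linext_sum unfolding fock_act_def[symmetric]
    using x SpD(1)[OF g] alpha_beta_V
    by (intro sum.cong refl) (simp add: fock_act_vop upper_def[symmetric])
  also have "\<dots> = (\<Sum>i = 1..N. wedge (vop (g (alpha_vec i)) (vop (g (beta_vec i)) (bas {}))) (fock_act N g x))"
    using x by (intro sum.cong refl) (simp add: wedge_vop)
  also have "\<dots> = wedge (eta N) (fock_act N g x)"
    unfolding Sp_eta_vop[OF g] wedge_sum_left ..
  finally show ?thesis .
qed

text \<open>The summands of \<open>\<eta>\<^sub>N \<and> _\<close>.  They commute and square to zero, so
  \<open>\<eta>\<^sub>N\<^sup>N\<close> is \<open>N!\<close> times their product.\<close>

definition pair_op :: "nat \<Rightarrow> ext \<Rightarrow> ext"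
  where "pair_op i x = vop (alpha_vec i) (vop (beta_vec i) x)"

lemma upper_pair_op [simp]: "upper x \<Longrightarrow> upper (pair_op i x)"
  by (simp add: pair_op_def)

lemma pair_op_lin: "pair_op i (x + y) = pair_op i x + pair_op i y" "pair_op i (c *\<^sub>C x) = c *\<^sub>C pair_op i x"
  by (simp_all add: pair_op_def vop_lin)

lemma pair_op_commute: "upper x \<Longrightarrow> pair_op i (pair_op j x) = pair_op j (pair_op i x)"
proof -
  assume x: "upper x"
  have c: "vop v (vop w (vop u y)) = vop w (vop u (vop v y))" if "upper y" for v w u y
  proof -
    have "vop v (vop w (vop u y)) = - vop w (vop v (vop u y))"
      using that by (intro acomm_vop) (simp add: upper_def[symmetric])
    also have "vop v (vop u y) = - vop u (vop v y)"
      using that by (intro acomm_vop) (simp add: upper_def[symmetric])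
    finally show ?thesis by (simp add: vop_uminus)
  qed
  show ?thesis unfolding pair_op_def using x by (simp add: c[of _ "alpha_vec i"] c[of _ _ "alpha_vec j" "beta_vec j"])
qed

lemma pair_op_self: "upper x \<Longrightarrow> pair_op i (pair_op i x) = 0"
proof -
  assume x: "upper x"
  let ?a = "alpha_vec i" and ?b = "beta_vec i"
  have "vop ?b (vop ?a (vop ?b x)) = - vop ?a (vop ?b (vop ?b x))"
    using x by (intro acomm_vop) (simp add: upper_def[symmetric])
  also have "vop ?b (vop ?b x) = 0"
    using x by (intro vop_vop_self) (simp add: upper_def[symmetric])
  finally show ?thesis by (simp add: pair_op_def)
qed

abbreviation eta_pow :: "nat \<Rightarrow> nat \<Rightarrow> ext \<Rightarrow> ext"
  where "eta_pow M k \<equiv> wedge (eta M) ^^ k"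

lemma upper_eta_pow [simp]: "upper x \<Longrightarrow> upper (eta_pow M k x)"
  by (induction k) auto

lemma wedge_eta_Suc: "upper x \<Longrightarrow> wedge (eta (Suc M)) x = wedge (eta M) x + pair_op (Suc M) x"
  by (simp add: wedge_eta pair_op_def)

lemma pair_op_wedge_eta: "upper x \<Longrightarrow> pair_op i (wedge (eta M) x) = wedge (eta M) (pair_op i x)"
proof -
  have s: "pair_op i (sum f I) = (\<Sum>j\<in>I. pair_op i (f j))" for f :: "nat \<Rightarrow> ext" and I
    by (induction I rule: infinite_finite_induct) (auto simp: pair_op_lin, simp_all add: pair_op_def)
  assume "upper x"
  then show ?thesis
    by (simp add: wedge_eta s flip: pair_op_def) (simp add: pair_op_commute)
qed

lemma pair_op_eta_pow: "upper x \<Longrightarrow> pair_op i (eta_pow M k x) = eta_pow M k (pair_op i x)"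
  by (induction k) (simp_all add: pair_op_wedge_eta)

lemma eta_pow_lin: "eta_pow M k (c *\<^sub>C x) = c *\<^sub>C eta_pow M k x"
  by (induction k) (simp_all add: wedge_scale_right)

text \<open>The binomial formula for \<open>(\<eta>\<^sub>M + p)\<^sup>k\<close>, where \<open>p\<^sup>2 = 0\<close> leaves two terms.\<close>

lemma eta_pow_Suc_level:
  assumes "upper x"
  shows "eta_pow (Suc M) k x = eta_pow M k x + of_nat k *\<^sub>C eta_pow M (k - 1) (pair_op (Suc M) x)"
proof (induction k)
  case 0 show ?case by simp
next
  case (Suc k)
  let ?p = "pair_op (Suc M)"
  have "eta_pow (Suc M) (Suc k) x =
      eta_pow M (Suc k) x + of_nat k *\<^sub>C wedge (eta M) (eta_pow M (k - 1) (?p x))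
      + (?p (eta_pow M k x) + of_nat k *\<^sub>C ?p (eta_pow M (k - 1) (?p x)))"
    using Suc assms
    by (simp add: wedge_eta_Suc wedge_add_right wedge_scale_right pair_op_lin pm.scale_right_distrib)
  also have "?p (eta_pow M k x) = eta_pow M k (?p x)"
    using assms by (rule pair_op_eta_pow)
  also have "?p (eta_pow M (k - 1) (?p x)) = eta_pow M (k - 1) (0 *\<^sub>C x)"
    using assms by (simp add: pair_op_eta_pow pair_op_self)
  also have "\<dots> = 0" by (simp only: eta_pow_lin) simp
  also have "of_nat k *\<^sub>C wedge (eta M) (eta_pow M (k - 1) (?p x)) = of_nat k *\<^sub>C eta_pow M k (?p x)"
    by (cases k) auto
  finally show ?case by (simp add: pm.scale_left_distrib)
qed

primrec pair_prod :: "nat \<Rightarrow> ext \<Rightarrow> ext"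
  where "pair_prod 0 x = x" | "pair_prod (Suc M) x = pair_prod M (pair_op (Suc M) x)"

text \<open>The vanishing of the next power is what makes the first term of \<open>eta_pow_Suc_level\<close>
  disappear in the induction.\<close>

lemma eta_pow_top:
  "upper x \<Longrightarrow> eta_pow M M x = fact M *\<^sub>C pair_prod M x \<and> eta_pow M (Suc M) x = 0"
proof (induction M arbitrary: x)
  case 0 then show ?case by (simp add: wedge_eta)
next
  case (Suc M)
  have 1: "eta_pow M (Suc M) y = 0" "eta_pow M (Suc (Suc M)) y = 0" if "upper y" for y
    using Suc.IH[OF that, THEN conjunct2] wedge_scale_right[of "eta M" 0 0] by simp_all
  show ?case
    using Suc.prems Suc.IH[of "pair_op (Suc M) x"] 1[of x] 1[of "pair_op (Suc M) x"]
    by (simp add: eta_pow_Suc_level[OF Suc.prems] del: funpow.simps)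
qed

lemma pair_prod_lin: "pair_prod M (c *\<^sub>C x) = c *\<^sub>C pair_prod M x"
  by (induction M arbitrary: x) (simp_all add: pair_op_lin)

lemma pair_prod_bas:
  assumes "S \<inter> win M = {}"
  shows "\<exists>c. c \<noteq> 0 \<and> pair_prod M (bas S) = c *\<^sub>C bas (S \<union> win M)"
  using assms
proof (induction M arbitrary: S)
  case 0 show ?case by (intro exI[of _ 1]) (simp add: win_def)
next
  case (Suc M)
  let ?T = "insert (- int M) (insert (int M + 1) S)"
  have w: "win (Suc M) = insert (- int M) (insert (int M + 1) (win M))" by (auto simp: win_def)
  then have n: "int M + 1 \<notin> S" "- int M \<notin> insert (int M + 1) S" using Suc.prems by auto
  have "pair_op (Suc M) (bas S) =
      psis (- int M) (psis (int M + 1) (bas S))"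
    by (simp add: pair_op_def alpha_vec_def beta_vec_def vop_bas add.commute)
  then have "pair_op (Suc M) (bas S) = ((-1) ^ n_above (int M + 1) S *
      (-1) ^ n_above (- int M) (insert (int M + 1) S)) *\<^sub>C bas ?T"
    using n by (simp add: psis_bas psis_lin)
  then obtain c where c: "pair_op (Suc M) (bas S) = c *\<^sub>C bas ?T" "c \<noteq> 0"
    by (rule that) simp
  have "?T \<inter> win M = {}" using Suc.prems w by (auto simp: win_def)
  then obtain d where "d \<noteq> 0" "pair_prod M (bas ?T) = d *\<^sub>C bas (?T \<union> win M)"
    using Suc.IH by blast
  then have "pair_prod (Suc M) (bas S) = (c * d) *\<^sub>C bas (S \<union> win (Suc M))" "c * d \<noteq> 0"
    using c by (simp_all add: pair_prod_lin w)
  then show ?case by blast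
qed

text \<open>This is \<open>det g = 1\<close>.  As \<open>|2N\<rangle>\<close> is a nonzero multiple of \<open>\<eta>\<^sub>N\<^sup>N \<and> |-2N\<rangle>\<close>, it is fixed because
  \<open>\<eta>\<^sub>N\<close> and \<open>|-2N\<rangle>\<close> are.\<close>

lemma fock_act_vac:
  assumes g: "g \<in> carrier (Sp N)"
  shows "fock_act N g (vac (int N)) = vac (int N)"
proof -
  let ?F = "fock_act N g" and ?v = "vac (- int N)"
  have d: "{..- int N} \<inter> win N = {}" "{..- int N} \<union> win N = {..int N}" by (auto simp: win_def)
  have "?F (eta_pow N k ?v) = eta_pow N k ?v" for k
    by (induction k) (simp_all add: fock_act_eta[OF g], simp add: vac_def fock_act_outside d)
  moreover obtain c where c: "c \<noteq> 0" "pair_prod N ?v = c *\<^sub>C vac (int N)"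
    using pair_prod_bas[OF d(1)] by (auto simp: vac_def d)
  then have "eta_pow N N ?v = (fact N * c) *\<^sub>C vac (int N)"
    using eta_pow_top[of ?v N] by simp
  ultimately have "(fact N * c) *\<^sub>C ?F (vac (int N)) = (fact N * c) *\<^sub>C vac (int N)"
    by (metis fock_act_lin(2))
  then show ?thesis using c(1) by simp
qed

section \<open>Equivariance of the comparison maps\<close>

text \<open>The reflection \<open>n \<mapsto> 1 - n\<close> maps the window to itself.\<close>

lemma contr_outside:
  assumes "v \<in> V N" "B \<inter> win N = {}"
  shows "contr v (bas B) = 0"
proof -
  have "contr v (bas B) = linext (\<lambda>_. 0) v"
    unfolding contr_def
  proof (rule linext_eqI)
    fix n assume "n \<in> keys v"
    then have "1 - n \<in> win N" using V_keys[OF assms(1)] by (auto simp: win_def)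
    then show "eps n *\<^sub>C psi (1 - n) (bas B) = 0" using assms(2) by (auto simp: psi_bas)
  qed
  then show ?thesis by simp
qed

text \<open>Induction over the factors of a monomial that lie in \<open>V\<^sub>N\<close>: \<open>contr_vop\<close> moves the contraction
  past a factor, and the scalar it produces does not change under \<open>g\<close> by \<open>sform_invariant\<close>.
  Without such factors both sides vanish.\<close>

lemma fock_act_contr:
  assumes g: "g \<in> carrier (Sp N)" and v: "v \<in> V N" and x: "upper x"
  shows "fock_act N g (contr v x) = contr (g v) (fock_act N g x)"
  using _ _ _ x
proof (rule linear_on_upper_eqI)
  show "Vector_Spaces.linear cscale cscale (\<lambda>x. fock_act N g (contr v x))"
    "Vector_Spaces.linear cscale cscale (\<lambda>x. contr (g v) (fock_act N g x))"
    by (intro linearI; simp add: contr_lin fock_act_lin)+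
  fix S :: "int set" assume "bdd_above S"
  then show "fock_act N g (contr v (bas S)) = contr (g v) (fock_act N g (bas S))"
  proof (induction rule: window_induct[where N = N])
    case (outside B)
    then show ?case
      using v SpD(5)[OF g v] by (simp add: contr_outside fock_act_outside fock_act_lin)
  next
    case (insert n S)
    let ?x = "bas S"
    have x: "upper ?x" using insert(3) by simp
    have n: "bas n \<in> V N" using insert(1) by (rule bas_in_V)
    have F: "fock_act N g (vop (bas n) y) = vop (g (bas n)) (fock_act N g y)" if "upper y" for y
      using that n SpD(1)[OF g] by (intro fock_act_vop) (simp_all add: upper_def)
    have "fock_act N g (contr v (vop (bas n) ?x)) =
        sform v (bas n) *\<^sub>C fock_act N g ?x - vop (g (bas n)) (fock_act N g (contr v ?x))"
      using x fock_act_lin(1)[of N g _ "- vop (bas n) (contr v ?x)"]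
        fock_act_lin(2)[of N g "-1" "vop (bas n) (contr v ?x)"]
      by (simp add: contr_vop fock_act_lin F)
    also have "\<dots> = contr (g v) (vop (g (bas n)) (fock_act N g ?x))"
      using x insert.IH by (simp add: contr_vop sform_invariant[OF g v n])
    also have "\<dots> = contr (g v) (fock_act N g (vop (bas n) ?x))"
      using x by (simp add: F)
    finally show ?case
      using insert(2) by (simp add: bas_insert contr_lin fock_act_lin)
  qed
qed

lemma fock_act_contr_act:
  assumes g: "g \<in> carrier (Sp N)" and x: "\<forall>A\<in>keys x. A \<subseteq> win N" and z: "upper z"
  shows "fock_act N g (contr_act x z) = contr_act (ext_map g x) (fock_act N g z)"
proof -
  have "fock_act N g (contr_act (bas A) z) = contr_act (ext_map g (bas A)) (fock_act N g z)"
    if "A \<subseteq> win N" for A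
  proof -
    have "finite A" using that finite_win by (rule finite_subset)
    then show ?thesis using that
    proof (induction A rule: finite_linorder_max_induct)
      case empty show ?case by (simp add: contr_act_bas)
    next
      case (insert b A)
      then have b: "bas b \<in> V N" by (intro bas_in_V) auto
      have i: "bas (insert b A) = vop (bas b) (bas A)" by (rule bas_insert_max[OF insert.hyps(2)])
      have "fock_act N g (contr_act (bas (insert b A)) z) =
          contr (g (bas b)) (contr_act (ext_map g (bas A)) (fock_act N g z))"
        using insert b z unfolding i by (simp add: contr_act_vop fock_act_contr[OF g])
      also have "\<dots> = contr_act (ext_map g (bas (insert b A))) (fock_act N g z)"
        using insert.hyps z SpD(1)[OF g] unfolding i by (simp add: contr_act_vop ext_map_vop)
      finally show ?case .
    qed
  qed
  then have "linext (\<lambda>A. fock_act N g (contr_act (bas A) z)) x =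
      linext (\<lambda>A. contr_act (ext_map g (bas A)) (fock_act N g z)) x"
    using x by (intro linext_eqI) auto
  then have "fock_act N g (contr_act (linext bas x) z) = contr_act (ext_map g (linext bas x)) (fock_act N g z)"
    by (simp only: contr_act_linext ext_map_linext fock_act_linext)
  then show ?thesis by simp
qed

text \<open>Equivariance of the comparison map; here both the invariance of the form and that of the
  vacuum enter.\<close>

lemma fock_act_Phi:
  assumes "g \<in> carrier (Sp N)" "\<forall>A\<in>keys x. A \<subseteq> win N"
  shows "fock_act N g (Phi N x) = Phi N (ext_map g x)"
  using assms by (simp add: fock_act_contr_act fock_act_vac)

lemma ext_map_ext_power:
  assumes g: "g \<in> carrier (Sp N)" and x: "x \<in> ext_power N k"
  shows "ext_map g x \<in> ext_power N k"
  unfolding ext_map_def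
proof (rule linext_subspace[OF ext_power_subspace])
  fix A assume "A \<in> keys x"
  then have A: "A \<subseteq> win N" "int (card A) = k" using x by (auto simp: ext_power_def)
  then have "finite A" using finite_win finite_subset by blast
  then have "A \<subseteq> win N \<Longrightarrow> img_wedge g A (bas {}) \<in> ext_power N (int (card A))"
  proof (induction A rule: finite_linorder_max_induct)
    case empty show ?case by (simp add: ext_power_bas_empty)
  next
    case (insert b A)
    have "b \<in> win N" "b \<notin> A" using insert by auto
    then have "keys (g (bas b)) \<subseteq> win N" using SpD(5)[OF g bas_in_V] V_keys by blast
    then show ?case
      using insert vop_ext_power[of "g (bas b)" N "img_wedge g A (bas {})" "int (card A)"] \<open>b \<notin> A\<close>
      by (simp add: img_wedge_insert_max add.commute)
  qed
  then show "img_wedge g A (bas {}) \<in> ext_power N k" using A by simp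
qed

lemma ext_map_eta:
  assumes g: "g \<in> carrier (Sp N)" and x: "x \<in> ext_power N k"
  shows "ext_map g (wedge (eta N) x) = wedge (eta N) (ext_map g x)"
proof -
  have "wedge (eta N) x \<in> ext_power N (2 + k)"
    using eta_ext_power x by (rule wedge_ext_power)
  then have "fock_act N g (wedge (eta N) x) = ext_map g (wedge (eta N) x)"
    "fock_act N g x = ext_map g x"
    using x by (auto simp: ext_power_def intro!: fock_act_finite)
  then show ?thesis using fock_act_eta[OF g, of x] ext_power_finitary[OF x] by simp
qed

text \<open>Needed because \<open>W_act\<close> takes the union over all \<open>N\<close> with \<open>g \<in> Sp(2N)\<close>.\<close>

lemma fock_act_indep:
  assumes g: "g \<in> carrier (Sp N)" and "N \<le> N'" and x: "upper x"
  shows "fock_act N' g x = fock_act N g x"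
  using _ _ _ x
proof (rule linear_on_upper_eqI)
  show "Vector_Spaces.linear cscale cscale (fock_act N' g)"
    "Vector_Spaces.linear cscale cscale (fock_act N g)"
    by (intro linearI; simp add: fock_act_lin)+
  fix S :: "int set" assume "bdd_above S"
  then show "fock_act N' g (bas S) = fock_act N g (bas S)"
  proof (induction rule: window_induct[where N = N])
    case (outside B)
    from outside have "fock_act N' g (bas B) = bas B"
    proof (induction rule: window_induct[where N = N'])
      case (outside B)
      then show ?case by (simp add: fock_act_outside)
    next
      case (insert n B)
      then have "g (bas n) = bas n" using SpD(3)[OF g] by auto
      then show ?case using insert
        by (simp add: bas_insert fock_act_lin fock_act_psis vop_bas)
    qed
    then show ?case using outside by (simp add: fock_act_outside)
  next
    case (insert n S)
    moreover have "n \<in> win N'" using insert(1) win_mono[OF \<open>N \<le> N'\<close>] by auto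
    ultimately show ?case
      by (simp add: bas_insert fock_act_lin fock_act_psis vop_bas[of n])
  qed
qed

section \<open>Quotients by subspaces\<close>

text \<open>The elements of \<open>quot_mod (subspace_mod A) U\<close>, as sets.\<close>

definition coset :: "('a \<Rightarrow>\<^sub>0 complex) set \<Rightarrow> ('a \<Rightarrow>\<^sub>0 complex) \<Rightarrow> ('a \<Rightarrow>\<^sub>0 complex) set"
  where "coset U x = (\<lambda>u. u + x) ` U"

lemma a_r_coset_subspace_mod: "U +>\<^bsub>subspace_mod A\<^esub> x = coset U x"
  by (auto simp: a_r_coset_def r_coset_def subspace_mod_def coset_def)

lemma coset_iff: "y \<in> coset U x \<longleftrightarrow> y - x \<in> U"
  by (auto simp: coset_def image_iff intro: bexI[of _ "y - x"])

lemma coset_self: "pm.subspace U \<Longrightarrow> x \<in> coset U x"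
  by (simp add: coset_iff pm.subspace_0)

lemma coset_eq_iff:
  assumes "pm.subspace U"
  shows "coset U x = coset U y \<longleftrightarrow> x - y \<in> U"
proof
  assume "coset U x = coset U y"
  then show "x - y \<in> U" using coset_self[OF assms] coset_iff by metis
next
  assume d: "x - y \<in> U"
  have "z - x \<in> U \<longleftrightarrow> z - y \<in> U" for z
    using pm.subspace_add[OF assms _ d, of "z - x"] pm.subspace_diff[OF assms _ d, of "z - y"] by auto
  then show "coset U x = coset U y" by (auto simp: coset_iff)
qed

lemma carrier_quot: "carrier (quot_mod (subspace_mod A) U) = coset U ` A"
  by (auto simp: quot_mod_def A_RCOSETS_def RCOSETS_def subspace_mod_def r_coset_def coset_def)

lemma add_quot:
  assumes "pm.subspace U"
  shows "coset U x \<oplus>\<^bsub>quot_mod (subspace_mod A) U\<^esub> coset U y = coset U (x + y)"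
proof -
  have "coset U x \<oplus>\<^bsub>quot_mod (subspace_mod A) U\<^esub> coset U y = {a + b | a b. a \<in> coset U x \<and> b \<in> coset U y}"
    by (auto simp: quot_mod_def set_add_def set_mult_def subspace_mod_def)
  also have "\<dots> = coset U (x + y)"
  proof (intro equalityI subsetI)
    fix z assume "z \<in> {a + b | a b. a \<in> coset U x \<and> b \<in> coset U y}"
    then obtain a b where "z = a + b" "a - x \<in> U" "b - y \<in> U" by (auto simp: coset_iff)
    then show "z \<in> coset U (x + y)"
      using pm.subspace_add[OF assms, of "a - x" "b - y"] by (simp add: coset_iff algebra_simps)
  next
    fix z assume "z \<in> coset U (x + y)"
    then have "z - y \<in> coset U x" by (simp add: coset_iff algebra_simps)
    then show "z \<in> {a + b | a b. a \<in> coset U x \<and> b \<in> coset U y}"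
      using coset_self[OF assms, of y] by force
  qed
  finally show ?thesis .
qed

lemma quot_map_coset:
  assumes "pm.subspace U" "pm.subspace U'" "\<And>u. u \<in> U' \<Longrightarrow> f (u + x) - f x \<in> U"
  shows "quot_map (subspace_mod A) U f (coset U' x) = coset U (f x)"
  unfolding quot_map_def a_r_coset_subspace_mod
proof (rule SUP_eq_const)
  show "coset U' x \<noteq> {}" using coset_self[OF assms(2)] by blast
  fix y assume "y \<in> coset U' x"
  then have "f (y - x + x) - f x \<in> U" by (intro assms(3)) (simp add: coset_iff)
  then show "coset U (f y) = coset U (f x)" by (simp add: coset_eq_iff[OF assms(1)])
qed

lemma smult_quot:
  assumes "pm.subspace U"
  shows "c \<odot>\<^bsub>quot_mod (subspace_mod A) U\<^esub> coset U x = coset U (c *\<^sub>C x)"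
proof -
  have "c \<odot>\<^bsub>quot_mod (subspace_mod A) U\<^esub> coset U x = quot_map (subspace_mod A) U (cscale c) (coset U x)"
    by (simp add: quot_mod_def quot_map_def subspace_mod_def)
  also have "\<dots> = coset U (c *\<^sub>C x)"
    using assms by (intro quot_map_coset) (auto simp: pm.scale_right_distrib intro: pm.subspace_scale)
  finally show ?thesis .
qed

section \<open>The images of multiplication by the bivector and of its contraction\<close>

abbreviation (input) omega_image :: "int \<Rightarrow> ext set"
  where "omega_image m \<equiv> omega ` fock (m + 2)"

lemma omega_level: "z \<in> level N m \<Longrightarrow> omega z = - contr_act (eta N) z"
  by (intro omega_bounded) (simp add: level_def)

lemma subspace_image:
  assumes "pm.subspace A" "\<And>x y. x \<in> A \<Longrightarrow> y \<in> A \<Longrightarrow> f (x + y) = f x + f y"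
    "\<And>c x. x \<in> A \<Longrightarrow> f (c *\<^sub>C x) = c *\<^sub>C f x"
  shows "pm.subspace (f ` A)"
  unfolding pm.subspace_def
proof (intro conjI ballI allI)
  have "f (0 *\<^sub>C 0) = 0 *\<^sub>C f 0" using assms(3) pm.subspace_0[OF assms(1)] .
  then show "0 \<in> f ` A" using pm.subspace_0[OF assms(1)] by (auto intro: image_eqI[of _ f 0])
  show "a + b \<in> f ` A" if ab: "a \<in> f ` A" "b \<in> f ` A" for a b
  proof -
    obtain x y where "x \<in> A" "y \<in> A" "a = f x" "b = f y" using ab by blast
    then show ?thesis using assms(2)[of x y] pm.subspace_add[OF assms(1)] by (metis image_eqI)
  qed
  show "c *\<^sub>C a \<in> f ` A" if a: "a \<in> f ` A" for a c
  proof -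
    obtain x where "x \<in> A" "a = f x" using a by blast
    then show ?thesis using assms(3)[of x c] pm.subspace_scale[OF assms(1)] by (metis image_eqI)
  qed
qed

lemma fock_subspace: "pm.subspace (fock m)"
  unfolding fock_def by (rule pm.subspace_span)

lemma fock_level_large:
  assumes "z \<in> fock m"
  shows "\<exists>N0. \<forall>N\<ge>N0. z \<in> level N m"
  using fock_level_ex[OF assms] level_mono by blast

lemma omega_add:
  assumes "x \<in> fock m" "y \<in> fock m"
  shows "omega (x + y) = omega x + omega y"
proof -
  obtain K L where "\<forall>N\<ge>K. x \<in> level N m" "\<forall>N\<ge>L. y \<in> level N m"
    using assms fock_level_large by blast
  then have "x \<in> level (max K L) m" "y \<in> level (max K L) m" by auto
  moreover from this have "x + y \<in> level (max K L) m" by (rule pm.subspace_add[OF level_subspace])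
  ultimately show ?thesis by (simp add: omega_level[of _ "max K L" m] contr_act_lin)
qed

lemma omega_scale:
  assumes "x \<in> fock m"
  shows "omega (c *\<^sub>C x) = c *\<^sub>C omega x"
proof -
  obtain K where "x \<in> level K m" using assms fock_level_ex by blast
  moreover from this have "c *\<^sub>C x \<in> level K m" by (rule pm.subspace_scale[OF level_subspace])
  ultimately show ?thesis by (simp add: omega_level[of _ K m] contr_act_lin)
qed

lemma omega_image_subspace: "pm.subspace (omega_image m)"
  by (rule subspace_image[OF fock_subspace]) (auto intro: omega_add omega_scale)

lemma eta_ideal_subspace: "pm.subspace (eta_ideal N k)"
  unfolding eta_ideal_def
  by (rule subspace_image[OF ext_power_subspace]) (auto simp: wedge_add_right wedge_scale_right)

lemma eta_ideal_ext_power: "eta_ideal N k \<subseteq> ext_power N k"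
  using wedge_ext_power[OF eta_ext_power] by (fastforce simp: eta_ideal_def)

text \<open>The comparison maps take \<open>\<eta>\<^sub>N \<and> _\<close> to \<open>- \<omega>\<close>.  The following lemmas turn this into a
  comparison of the two subspaces that are divided out.\<close>

lemma Phi_eta_level:
  assumes "x \<in> ext_power N (int N - m)"
  shows "Phi N (wedge (eta N) x) = - omega (Phi N x)"
  using Phi_level[OF assms] by (intro Phi_eta ext_power_finitary[OF assms]) (simp add: level_def)

lemma Phi_inject_iff:
  assumes "x \<in> ext_power N k" "y \<in> ext_power N k"
  shows "Phi N x = Phi N y \<longleftrightarrow> x = y"
proof
  assume "Phi N x = Phi N y"
  then have "Phi N (x - y) = 0" by (simp add: contr_act_diff)
  moreover have "x - y \<in> ext_power N k" using assms by (rule pm.subspace_diff[OF ext_power_subspace])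
  ultimately show "x = y" using Phi_inject[of "x - y" N] by (auto simp: ext_power_def)
qed simp

lemma Phi_eta_ideal:
  assumes "x \<in> eta_ideal N (int N - m)"
  shows "Phi N x \<in> omega_image m"
proof -
  obtain y where y: "y \<in> ext_power N (int N - (m + 2))" "x = wedge (eta N) y"
    using assms by (auto simp: eta_ideal_def algebra_simps)
  have "- y \<in> ext_power N (int N - (m + 2))"
    using y(1) by (rule pm.subspace_neg[OF ext_power_subspace])
  then have "Phi N (- y) \<in> fock (m + 2)" by (intro level_fock[of _ N] Phi_level)
  moreover have "Phi N x = omega (Phi N (- y))"
    using Phi_eta_level[OF \<open>- y \<in> _\<close>] wedge_scale_right[of "eta N" "-1" y]
    by (simp add: y(2) contr_act_uminus)
  ultimately show ?thesis by blast
qed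

text \<open>A vector \<open>z\<close> with \<open>Phi N x = \<omega> z\<close> may live at a later level \<open>K\<close> than \<open>N\<close>; it is
  at that level that \<open>x\<close> is shown to become a multiple of the bivector.\<close>

lemma Phi_omega_eventually:
  assumes x: "x \<in> ext_power N (int N - m)" and omega_image: "Phi N x \<in> omega_image m"
  shows "\<exists>K\<ge>N. wedge_alphas N K x \<in> eta_ideal K (int K - m)"
proof -
  obtain z where z: "z \<in> fock (m + 2)" "Phi N x = omega z" using omega_image by blast
  obtain K0 where "z \<in> level K0 (m + 2)" using fock_level_ex[OF z(1)] ..
  then have "z \<in> level (max N K0) (m + 2)" using level_mono by simp
  then obtain K where K: "K \<ge> N" "z \<in> level K (m + 2)" using max.cobounded1 by blast
  obtain y where y: "y \<in> ext_power K (int K - (m + 2))" "Phi K y = z" using Phi_surj[OF K(2)] .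
  let ?y = "- y"
  have y': "?y \<in> ext_power K (int K - (m + 2))" using y(1) by (rule pm.subspace_neg[OF ext_power_subspace])
  then have yi: "wedge (eta K) ?y \<in> eta_ideal K (int K - m)"
    by (auto simp: eta_ideal_def algebra_simps)
  have "Phi K (wedge_alphas N K x) = Phi N x"
    using Phi_wedge_alphas[OF ext_power_finitary[OF x] K(1)] by simp
  also have "\<dots> = Phi K (wedge (eta K) ?y)"
    using Phi_eta_level[OF y(1)] wedge_scale_right[of "eta K" "-1" y] z(2) y(2)
    by (simp add: contr_act_uminus)
  finally have "wedge_alphas N K x = wedge (eta K) ?y"
    using Phi_inject_iff[OF wedge_alphas_ext_power[OF x K(1)]] eta_ideal_ext_power yi by blast
  then show ?thesis using K(1) yi by auto
qed

text \<open>The transition maps are well defined on the quotients.  Injectivity of \<open>Phi K\<close> replaces the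
  direct computation.\<close>

lemma wedge_alphas_eta_ideal:
  assumes x: "x \<in> eta_ideal N (int N - m)" and N: "N \<le> K"
  shows "wedge_alphas N K x \<in> eta_ideal K (int K - m)"
proof -
  obtain y where y: "y \<in> ext_power N (int N - (m + 2))" "x = wedge (eta N) y"
    using x by (auto simp: eta_ideal_def algebra_simps)
  let ?y = "wedge_alphas N K y"
  have y': "?y \<in> ext_power K (int K - (m + 2))" by (rule wedge_alphas_ext_power[OF y(1) N])
  then have yi: "wedge (eta K) ?y \<in> eta_ideal K (int K - m)"
    by (auto simp: eta_ideal_def algebra_simps)
  have xp: "x \<in> ext_power N (int N - m)" using x eta_ideal_ext_power by blast
  have "Phi K (wedge_alphas N K x) = Phi K (wedge (eta K) ?y)"
    using Phi_wedge_alphas[OF ext_power_finitary[OF xp] N]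
      Phi_wedge_alphas[OF ext_power_finitary[OF y(1)] N] Phi_eta_level[OF y(1)] Phi_eta_level[OF y'] y(2)
    by simp
  then have "wedge_alphas N K x = wedge (eta K) ?y"
    using Phi_inject_iff[OF wedge_alphas_ext_power[OF xp N]] eta_ideal_ext_power yi by blast
  then show ?thesis using yi by simp
qed

lemma wedge_alphas_trans:
  "N \<le> K \<Longrightarrow> K \<le> L \<Longrightarrow> wedge_alphas K L (wedge_alphas N K x) = wedge_alphas N L x"
  using upt_add_eq_append[of "Suc N" "Suc K" "L - K"] by (simp add: wedge_alphas_def)

section \<open>The isomorphism of the limit with the quotient of the Fock space\<close>

abbreviation level_class :: "nat \<Rightarrow> nat \<Rightarrow> ext \<Rightarrow> ext set"
  where "level_class m N \<equiv> coset (eta_ideal N (int N - int m))"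

abbreviation lim_rel :: "nat \<Rightarrow> ((nat \<times> ext set) \<times> (nat \<times> ext set)) set"
  where "lim_rel m \<equiv> dirlim_rel {m..} (\<lambda>N. M_fin N (int N - int m)) (M_trans m)"

text \<open>The isomorphism.  A class of the limit is the set of its representatives \<open>(N, x + \<eta>\<^sub>N \<and> _)\<close>, so
  the image of a coset \<open>X\<close> of the Fock space can be given by listing the pairs for which
  \<open>Phi N x\<close> lies in \<open>X\<close>; no representative of \<open>X\<close> has to be chosen.\<close>

definition limit_class :: "nat \<Rightarrow> ext set \<Rightarrow> (nat \<times> ext set) set"
  where "limit_class m X =
    {(N, level_class m N x) | N x. m \<le> N \<and> x \<in> ext_power N (int N - int m) \<and> Phi N x \<in> X}"

lemma limit_classI:
  assumes "m \<le> N" "x \<in> ext_power N (int N - int m)" "Phi N x - z \<in> omega_image (int m)"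
  shows "(N, level_class m N x) \<in> limit_class m (coset (omega_image (int m)) z)"
  using assms unfolding limit_class_def coset_iff by blast

lemma limit_classE:
  assumes "(N, X) \<in> limit_class m (coset (omega_image (int m)) z)"
  obtains x where "X = level_class m N x" "m \<le> N" "x \<in> ext_power N (int N - int m)"
    "Phi N x - z \<in> omega_image (int m)"
  using assms unfolding limit_class_def coset_iff by blast

lemma carrier_M_fin:
  "carrier (M_fin N (int N - int m)) = level_class m N ` ext_power N (int N - int m)"
  by (simp add: M_fin_def carrier_quot)

lemma M_trans_class:
  assumes "N \<le> K"
  shows "M_trans m N K (level_class m N x) = level_class m K (wedge_alphas N K x)"
  unfolding M_trans_def M_fin_map_def
  by (intro quot_map_coset eta_ideal_subspace) (simp add: wedge_alphas_lin wedge_alphas_eta_ideal assms)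

lemma level_class_eq_iff: "level_class m N x = level_class m N y \<longleftrightarrow> x - y \<in> eta_ideal N (int N - int m)"
  by (rule coset_eq_iff[OF eta_ideal_subspace])

lemma omega_class_eq_iff: "coset (omega_image m) x = coset (omega_image m) y \<longleftrightarrow> x - y \<in> omega_image m"
  by (rule coset_eq_iff[OF omega_image_subspace])

lemma wedge_alphas_diff: "wedge_alphas N K (x - y) = wedge_alphas N K x - wedge_alphas N K y"
  using wedge_alphas_lin(1)[of N K x "- y"] wedge_alphas_lin(2)[of N K "-1" y] by simp

lemma Phi_wedge_alphas_ext_power:
  "x \<in> ext_power N k \<Longrightarrow> N \<le> K \<Longrightarrow> Phi K (wedge_alphas N K x) = Phi N x"
  using Phi_wedge_alphas ext_power_finitary by blast

text \<open>Two representatives agree in the limit exactly if they have the same image in the quotient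
  of the Fock space: forwards by \<open>Phi_eta_ideal\<close>, backwards by \<open>Phi_omega_eventually\<close>.\<close>

lemma lim_rel_iff:
  assumes x: "x \<in> ext_power N (int N - int m)" and y: "y \<in> ext_power L (int L - int m)"
    and NL: "m \<le> N" "m \<le> L"
  shows "((N, level_class m N x), (L, level_class m L y)) \<in> lim_rel m
    \<longleftrightarrow> coset (omega_image (int m)) (Phi N x) = coset (omega_image (int m)) (Phi L y)"
proof -
  let ?d = "\<lambda>K. wedge_alphas N K x - wedge_alphas L K y"
  have d: "?d K \<in> ext_power K (int K - int m)" "Phi K (?d K) = Phi N x - Phi L y"
    if "N \<le> K" "L \<le> K" for K
    using that x y
    by (auto intro!: pm.subspace_diff[OF ext_power_subspace] wedge_alphas_ext_power
        simp: contr_act_diff Phi_wedge_alphas_ext_power[OF x] Phi_wedge_alphas_ext_power[OF y])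
  have "((N, level_class m N x), (L, level_class m L y)) \<in> lim_rel m
      \<longleftrightarrow> (\<exists>K\<ge>m. N \<le> K \<and> L \<le> K \<and> M_trans m N K (level_class m N x) = M_trans m L K (level_class m L y))"
    using assms by (auto simp: dirlim_rel_def carrier_M_fin)
  also have "\<dots> \<longleftrightarrow> (\<exists>K. N \<le> K \<and> L \<le> K \<and> ?d K \<in> eta_ideal K (int K - int m))"
  proof -
    have "M_trans m N K (level_class m N x) = M_trans m L K (level_class m L y)
        \<longleftrightarrow> ?d K \<in> eta_ideal K (int K - int m)" if "N \<le> K" "L \<le> K" for K
      using that by (simp add: M_trans_class level_class_eq_iff)
    moreover have "m \<le> K" if "N \<le> K" for K using NL(1) that by (rule order_trans)
    ultimately show ?thesis by metis
  qed
  also have "\<dots> \<longleftrightarrow> Phi N x - Phi L y \<in> omega_image (int m)"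
  proof
    assume "\<exists>K. N \<le> K \<and> L \<le> K \<and> ?d K \<in> eta_ideal K (int K - int m)"
    then obtain K where K: "N \<le> K" "L \<le> K" "?d K \<in> eta_ideal K (int K - int m)" by blast
    then show "Phi N x - Phi L y \<in> omega_image (int m)" using Phi_eta_ideal[OF K(3)] d(2)[OF K(1,2)] by simp
  next
    assume o: "Phi N x - Phi L y \<in> omega_image (int m)"
    let ?K = "max N L"
    obtain K where K: "?K \<le> K" "wedge_alphas ?K K (?d ?K) \<in> eta_ideal K (int K - int m)"
      using Phi_omega_eventually[OF d(1)[of ?K]] d(2)[of ?K] o by auto
    moreover have "wedge_alphas ?K K (?d ?K) = ?d K"
      using K(1) by (simp add: wedge_alphas_diff wedge_alphas_trans)
    ultimately show "\<exists>K. N \<le> K \<and> L \<le> K \<and> ?d K \<in> eta_ideal K (int K - int m)" by auto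
  qed
  finally show ?thesis by (simp add: omega_class_eq_iff)
qed

lemma lim_rel_Image:
  assumes "x \<in> ext_power N (int N - int m)" "m \<le> N"
  shows "lim_rel m `` {(N, level_class m N x)} = limit_class m (coset (omega_image (int m)) (Phi N x))"
    (is "?A = ?B")
proof (intro equalityI subsetI)
  fix p assume p: "p \<in> ?A"
  then obtain L y where y: "p = (L, level_class m L y)" "y \<in> ext_power L (int L - int m)" "m \<le> L"
    by (auto simp: dirlim_rel_def carrier_M_fin)
  then have "coset (omega_image (int m)) (Phi N x) = coset (omega_image (int m)) (Phi L y)"
    using p lim_rel_iff[OF assms(1) y(2) assms(2) y(3)] by simp
  then have "Phi L y \<in> coset (omega_image (int m)) (Phi N x)" using coset_self[OF omega_image_subspace] by metis
  then show "p \<in> ?B" using y by (auto simp: limit_class_def)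
next
  fix p assume "p \<in> ?B"
  then obtain L y where y: "p = (L, level_class m L y)" "y \<in> ext_power L (int L - int m)" "m \<le> L"
    "Phi L y \<in> coset (omega_image (int m)) (Phi N x)"
    by (auto simp: limit_class_def)
  then have "coset (omega_image (int m)) (Phi L y) = coset (omega_image (int m)) (Phi N x)"
    by (simp only: omega_class_eq_iff coset_iff)
  then show "p \<in> ?A"
    using y lim_rel_iff[OF assms(1) y(2) assms(2) y(3)] by simp
qed

lemma fock_Phi:
  assumes "z \<in> fock (int m)"
  shows "\<exists>N\<ge>K. m \<le> N \<and> (\<exists>x\<in>ext_power N (int N - int m). Phi N x = z)"
proof -
  obtain N0 where N0: "\<forall>N\<ge>N0. z \<in> level N (int m)" using fock_level_large[OF assms] ..
  let ?N = "max N0 (max m K)"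
  have "z \<in> level ?N (int m)" using N0 by simp
  then obtain x where "x \<in> ext_power ?N (int ?N - int m)" "Phi ?N x = z" using Phi_surj by blast
  then show ?thesis by (intro exI[of _ ?N]) auto
qed

lemma carrier_W: "carrier (W k) = coset (omega_image k) ` fock k"
  by (simp add: W_def carrier_quot)

lemma quotient_Sigma_image:
  "(SIGMA N:I. f N ` A N) // R = (\<Union>N\<in>I. \<Union>x\<in>A N. {R `` {(N, f N x)}})"
  by (auto simp: quotient_def)

lemma carrier_M_inf: "carrier (M_inf m) = limit_class m ` carrier (W (int m))"
proof -
  have "carrier (M_inf m) = (SIGMA N:{m..}. carrier (M_fin N (int N - int m))) // lim_rel m"
    by (simp add: M_inf_def dirlim_def Let_def)
  also have "\<dots> = {limit_class m (coset (omega_image (int m)) (Phi N x)) | N x.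
      m \<le> N \<and> x \<in> ext_power N (int N - int m)}" (is "_ = ?C")
  proof -
    have "(SIGMA N:{m..}. carrier (M_fin N (int N - int m))) // lim_rel m =
        (\<Union>N\<in>{m..}. \<Union>x\<in>ext_power N (int N - int m). {lim_rel m `` {(N, level_class m N x)}})"
      unfolding carrier_M_fin by (rule quotient_Sigma_image)
    also have "\<dots> = (\<Union>N\<in>{m..}. \<Union>x\<in>ext_power N (int N - int m).
        {limit_class m (coset (omega_image (int m)) (Phi N x))})"
      by (intro SUP_cong refl) (simp add: lim_rel_Image)
    also have "\<dots> = ?C" by auto
    finally show ?thesis .
  qed
  also have "\<dots> = limit_class m ` carrier (W (int m))"
  proof (intro equalityI subsetI)
    fix Y assume "Y \<in> ?C"
    then obtain N x where "Y = limit_class m (coset (omega_image (int m)) (Phi N x))"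
      "x \<in> ext_power N (int N - int m)" by blast
    then show "Y \<in> limit_class m ` carrier (W (int m))"
      unfolding carrier_W using level_fock[OF Phi_level] by blast
  next
    fix Y assume "Y \<in> limit_class m ` carrier (W (int m))"
    then obtain z where "Y = limit_class m (coset (omega_image (int m)) z)" "z \<in> fock (int m)"
      unfolding carrier_W by blast
    then show "Y \<in> ?C" using fock_Phi[of z m] by blast
  qed
  finally show ?thesis .
qed

lemma limit_class_inj: "inj_on (limit_class m) (carrier (W (int m)))"
  unfolding carrier_W
proof (intro inj_onI, elim imageE)
  fix X Y z w
  assume eq: "limit_class m X = limit_class m Y" and X: "X = coset (omega_image (int m)) z" "z \<in> fock (int m)"
    and Y: "Y = coset (omega_image (int m)) w"
  obtain N x where x: "m \<le> N" "x \<in> ext_power N (int N - int m)" "Phi N x = z"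
    using fock_Phi[OF X(2)] by blast
  then have "(N, level_class m N x) \<in> limit_class m Y"
    unfolding eq[symmetric] X(1) using pm.subspace_0[OF omega_image_subspace] by (intro limit_classI) auto
  then obtain y where y: "level_class m N x = level_class m N y" "Phi N y - w \<in> omega_image (int m)"
    unfolding Y by (auto elim: limit_classE)
  have "Phi N x - Phi N y \<in> omega_image (int m)"
    using Phi_eta_ideal[of "x - y" N "int m"] y(1) by (simp add: level_class_eq_iff contr_act_diff)
  from pm.subspace_add[OF omega_image_subspace this y(2)] have "z - w \<in> omega_image (int m)"
    using x(3) by simp
  then show "X = Y" by (simp only: X(1) Y omega_class_eq_iff)
qed

lemma limit_class_nonempty:
  "z \<in> fock (int m) \<Longrightarrow> limit_class m (coset (omega_image (int m)) z) \<noteq> {}"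
  using fock_Phi[of z m 0] limit_classI[of m _ _ z] pm.subspace_0[OF omega_image_subspace] by fastforce

lemma UN_pair_const:
  assumes "X \<noteq> {}" "\<And>a b. (a, b) \<in> X \<Longrightarrow> f a b = c"
  shows "(\<Union>(a, b)\<in>X. f a b) = c"
  using assms by (intro SUP_eq_const) auto

text \<open>The sum in the limit is a union over all pairs of representatives; by \<open>lim_rel_Image\<close> all of
  them contribute the same class.\<close>

lemma add_M_inf:
  assumes z: "z \<in> fock (int m)" and w: "w \<in> fock (int m)"
  shows "limit_class m (coset (omega_image (int m)) z) \<oplus>\<^bsub>M_inf m\<^esub> limit_class m (coset (omega_image (int m)) w) =
    limit_class m (coset (omega_image (int m)) (z + w))"
proof -
  let ?X = "limit_class m (coset (omega_image (int m)) z)" and ?Y = "limit_class m (coset (omega_image (int m)) w)"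
  let ?R = "\<lambda>N x N' y. lim_rel m `` {(max N N', M_trans m N (max N N') x
      \<oplus>\<^bsub>M_fin (max N N') (int (max N N') - int m)\<^esub> M_trans m N' (max N N') y)}"
  have R: "?R N x N' y = limit_class m (coset (omega_image (int m)) (z + w))"
    if X: "(N, x) \<in> ?X" and Y: "(N', y) \<in> ?Y" for N x N' y
  proof -
    let ?K = "max N N'"
    obtain u where u: "x = level_class m N u" "m \<le> N" "u \<in> ext_power N (int N - int m)"
      "Phi N u - z \<in> omega_image (int m)"
      by (rule limit_classE[OF X])
    obtain v where v: "y = level_class m N' v" "m \<le> N'" "v \<in> ext_power N' (int N' - int m)"
      "Phi N' v - w \<in> omega_image (int m)"
      by (rule limit_classE[OF Y])
    let ?s = "wedge_alphas N ?K u + wedge_alphas N' ?K v"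
    have s: "?s \<in> ext_power ?K (int ?K - int m)"
      using u v by (intro pm.subspace_add[OF ext_power_subspace] wedge_alphas_ext_power) auto
    have "?R N x N' y = lim_rel m `` {(?K, level_class m ?K ?s)}"
      unfolding u(1) v(1) by (simp add: M_trans_class M_fin_def add_quot eta_ideal_subspace)
    also have "\<dots> = limit_class m (coset (omega_image (int m)) (Phi ?K ?s))"
      using s u(2) by (intro lim_rel_Image) auto
    also have "Phi ?K ?s = Phi N u + Phi N' v"
      using u v by (simp add: contr_act_lin Phi_wedge_alphas_ext_power[OF u(3)] Phi_wedge_alphas_ext_power[OF v(3)])
    also have "coset (omega_image (int m)) (Phi N u + Phi N' v) = coset (omega_image (int m)) (z + w)"
      using pm.subspace_add[OF omega_image_subspace u(4) v(4)] by (simp add: omega_class_eq_iff algebra_simps)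
    finally show ?thesis .
  qed
  then have "(\<Union>(N, x)\<in>?X. \<Union>(N', y)\<in>?Y. ?R N x N' y) = limit_class m (coset (omega_image (int m)) (z + w))"
    by (intro UN_pair_const limit_class_nonempty z w R)
  then show ?thesis by (simp add: M_inf_def dirlim_def Let_def)
qed

lemma smult_M_inf:
  assumes z: "z \<in> fock (int m)"
  shows "c \<odot>\<^bsub>M_inf m\<^esub> limit_class m (coset (omega_image (int m)) z) = limit_class m (coset (omega_image (int m)) (c *\<^sub>C z))"
proof -
  let ?X = "limit_class m (coset (omega_image (int m)) z)"
  have R: "lim_rel m `` {(N, c \<odot>\<^bsub>M_fin N (int N - int m)\<^esub> x)} = limit_class m (coset (omega_image (int m)) (c *\<^sub>C z))"
    if X: "(N, x) \<in> ?X" for N x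
  proof -
    obtain u where u: "x = level_class m N u" "m \<le> N" "u \<in> ext_power N (int N - int m)"
      "Phi N u - z \<in> omega_image (int m)"
      by (rule limit_classE[OF X])
    have R: "lim_rel m `` {(N, c \<odot>\<^bsub>M_fin N (int N - int m)\<^esub> x)} = lim_rel m `` {(N, level_class m N (c *\<^sub>C u))}"
      unfolding u(1) by (simp add: M_fin_def smult_quot eta_ideal_subspace)
    also have "\<dots> = limit_class m (coset (omega_image (int m)) (Phi N (c *\<^sub>C u)))"
      using u by (intro lim_rel_Image pm.subspace_scale[OF ext_power_subspace])
    also have "coset (omega_image (int m)) (Phi N (c *\<^sub>C u)) = coset (omega_image (int m)) (c *\<^sub>C z)"
      using pm.subspace_scale[OF omega_image_subspace u(4), of c]
      by (simp add: omega_class_eq_iff contr_act_lin pm.scale_right_diff_distrib)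
    finally show ?thesis .
  qed
  then have "(\<Union>(N, x)\<in>?X. lim_rel m `` {(N, c \<odot>\<^bsub>M_fin N (int N - int m)\<^esub> x)}) =
      limit_class m (coset (omega_image (int m)) (c *\<^sub>C z))"
    by (intro UN_pair_const limit_class_nonempty z R)
  then show ?thesis by (simp add: M_inf_def dirlim_def Let_def)
qed

section \<open>Equivariance of the isomorphism\<close>

lemma fock_act_indep_Sp:
  assumes "g \<in> carrier (Sp N)" "g \<in> carrier (Sp K)" "upper x"
  shows "fock_act N g x = fock_act K g x"
  using fock_act_indep[OF assms(1) _ assms(3), of K] fock_act_indep[OF assms(2) _ assms(3), of N]
  by (cases "N \<le> K") auto

text \<open>At a level \<open>K \<ge> N\<close> both statements can be read off from the exterior power through
  \<open>Phi K\<close>.\<close>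

lemma fock_act_fock:
  assumes g: "g \<in> carrier (Sp N)" and z: "z \<in> level K k" and K: "N \<le> K"
  shows "fock_act N g z \<in> level K k" "fock_act N g (omega z) = omega (fock_act N g z)"
proof -
  have gK: "g \<in> carrier (Sp K)" using Sp_mono[OF K] g by blast
  obtain x where x: "x \<in> ext_power K (int K - k)" "Phi K x = z" using Phi_surj[OF z] .
  let ?x = "ext_map g x"
  have F: "fock_act N g (Phi K y) = Phi K (ext_map g y)" if "y \<in> ext_power K j" for y j
    using fock_act_Phi[OF gK, of y] that fock_act_indep[OF g K, of "Phi K y"]
    by (auto simp: ext_power_def)
  have x': "?x \<in> ext_power K (int K - k)" by (rule ext_map_ext_power[OF gK x(1)])
  show "fock_act N g z \<in> level K k" using Phi_level[OF x'] F[OF x(1)] x(2) by simp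
  have "fock_act N g (omega z) = fock_act N g (- Phi K (wedge (eta K) x))"
    using Phi_eta_level[OF x(1)] x(2) by simp
  also have "\<dots> = - Phi K (ext_map g (wedge (eta K) x))"
    using fock_act_lin(2)[of N g "-1" "Phi K (wedge (eta K) x)"]
      F[OF wedge_ext_power[OF eta_ext_power x(1)]] by simp
  also have "\<dots> = omega (fock_act N g z)"
    using Phi_eta_level[OF x'] F[OF x(1)] x(2) by (simp add: ext_map_eta[OF gK x(1)])
  finally show "fock_act N g (omega z) = omega (fock_act N g z)" .
qed

lemma fock_act_omega_image:
  assumes g: "g \<in> carrier (Sp N)" and z: "z \<in> omega_image k"
  shows "fock_act N g z \<in> omega_image k"
proof -
  obtain y where y: "y \<in> fock (k + 2)" "z = omega y" using z by blast
  obtain N0 where "\<forall>K\<ge>N0. y \<in> level K (k + 2)" using fock_level_large[OF y(1)] ..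
  then have "y \<in> level (max N N0) (k + 2)" by simp
  from fock_act_fock[OF g this] show ?thesis
    using level_fock y(2) by (metis image_eqI max.cobounded1)
qed

lemma fock_act_omega_class:
  assumes g: "g \<in> carrier (Sp N)" and "z - w \<in> omega_image k"
  shows "coset (omega_image k) (fock_act N g z) = coset (omega_image k) (fock_act N g w)"
proof -
  have "fock_act N g z - fock_act N g w = fock_act N g (z - w)"
    using fock_act_lin(1)[of N g "z - w" w] by simp
  then show ?thesis using fock_act_omega_image[OF assms] by (simp add: omega_class_eq_iff)
qed

lemma W_act_class:
  assumes g: "g \<in> carrier (Sp N)" and z: "z \<in> fock k"
  shows "W_act k g (coset (omega_image k) z) = coset (omega_image k) (fock_act N g z)"
  unfolding W_act_def
proof (rule SUP_eq_const)
  show "{N. g \<in> carrier (Sp N)} \<noteq> {}" using g by blast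
  fix K assume "K \<in> {N. g \<in> carrier (Sp N)}"
  then have K: "g \<in> carrier (Sp K)" by simp
  have "quot_map (subspace_mod (fock k)) (omega_image k) (fock_act K g) (coset (omega_image k) z) = coset (omega_image k) (fock_act K g z)"
    by (intro quot_map_coset omega_image_subspace) (simp add: fock_act_lin fock_act_omega_image[OF K])
  also have "fock_act K g z = fock_act N g z"
    by (rule fock_act_indep_Sp[OF K g upper_fock[OF z]])
  finally show "quot_map (subspace_mod (fock k)) (omega_image k) (fock_act K g) (coset (omega_image k) z) =
    coset (omega_image k) (fock_act N g z)" .
qed

lemma M_act_class:
  assumes g: "g \<in> carrier (Sp N)" and z: "z \<in> fock (int m)"
  shows "M_act m g (limit_class m (coset (omega_image (int m)) z)) = limit_class m (coset (omega_image (int m)) (fock_act N g z))"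
  unfolding M_act_def
proof (rule SUP_eq_const)
  let ?X = "limit_class m (coset (omega_image (int m)) z)"
  obtain K x where "K \<ge> N" "m \<le> K" "x \<in> ext_power K (int K - int m)" "Phi K x = z"
    using fock_Phi[OF z] by blast
  moreover from this have "g \<in> carrier (Sp K)" using Sp_mono g by blast
  ultimately have "(K, level_class m K x) \<in> {(N, x) \<in> ?X. g \<in> carrier (Sp N)}"
    using limit_classI[of m K x z] pm.subspace_0[OF omega_image_subspace] by auto
  then show "{(N, x) \<in> ?X. g \<in> carrier (Sp N)} \<noteq> {}" by blast
  fix p assume "p \<in> {(N, x) \<in> ?X. g \<in> carrier (Sp N)}"
  then obtain K x where p: "p = (K, level_class m K x)" "m \<le> K" "x \<in> ext_power K (int K - int m)"
    "Phi K x - z \<in> omega_image (int m)" and K: "g \<in> carrier (Sp K)"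
    by (auto elim!: limit_classE)
  have m: "M_fin_map K (int K - int m) (ext_map g) (level_class m K x) = level_class m K (ext_map g x)"
    unfolding M_fin_map_def
  proof (intro quot_map_coset eta_ideal_subspace)
    fix u assume "u \<in> eta_ideal K (int K - int m)"
    then obtain y where y: "y \<in> ext_power K (int K - int m - 2)" "u = wedge (eta K) y"
      by (auto simp: eta_ideal_def)
    then have "ext_map g u \<in> eta_ideal K (int K - int m)"
      using ext_map_eta[OF K y(1)] ext_map_ext_power[OF K y(1)] by (auto simp: eta_ideal_def)
    then show "ext_map g (u + x) - ext_map g x \<in> eta_ideal K (int K - int m)"
      by (simp add: ext_map_lin)
  qed
  have "lim_rel m `` {(K, M_fin_map K (int K - int m) (ext_map g) (level_class m K x))} =
      limit_class m (coset (omega_image (int m)) (Phi K (ext_map g x)))"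
    unfolding m using ext_map_ext_power[OF K p(3)] p(2) by (rule lim_rel_Image)
  also have "Phi K (ext_map g x) = fock_act K g (Phi K x)"
    using fock_act_Phi[OF K, of x] p(3) by (simp add: ext_power_def)
  also have "coset (omega_image (int m)) (fock_act K g (Phi K x)) = coset (omega_image (int m)) (fock_act K g z)"
    by (rule fock_act_omega_class[OF K p(4)])
  also have "fock_act K g z = fock_act N g z"
    by (rule fock_act_indep_Sp[OF K g upper_fock[OF z]])
  finally show "(case p of (N, x) \<Rightarrow> lim_rel m `` {(N, M_fin_map N (int N - int m) (ext_map g) x)}) =
    limit_class m (coset (omega_image (int m)) (fock_act N g z))"
    by (simp add: p(1))
qed

theorem proposition5:
  fixes m :: nat
  shows "\<exists>\<phi>. rep_iso Sp_inf (W (int m)) (W_act (int m)) (M_inf m) (M_act m) \<phi>"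
proof
  let ?\<phi> = "limit_class m" and ?c = "coset (omega_image (int m))"
  have add: "?c z \<oplus>\<^bsub>W (int m)\<^esub> ?c w = ?c (z + w)" for z w
    by (simp add: W_def add_quot omega_image_subspace)
  have smult: "a \<odot>\<^bsub>W (int m)\<^esub> ?c z = ?c (a *\<^sub>C z)" for a z
    by (simp add: W_def smult_quot omega_image_subspace)
  show "rep_iso Sp_inf (W (int m)) (W_act (int m)) (M_inf m) (M_act m) ?\<phi>"
    unfolding rep_iso_def
  proof (intro conjI allI ballI)
    have "bij_betw ?\<phi> (carrier (W (int m))) (carrier (M_inf m))"
      unfolding bij_betw_def using limit_class_inj carrier_M_inf by blast
    moreover have "?\<phi> (X \<oplus>\<^bsub>W (int m)\<^esub> Y) = ?\<phi> X \<oplus>\<^bsub>M_inf m\<^esub> ?\<phi> Y"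
      if "X \<in> carrier (W (int m))" "Y \<in> carrier (W (int m))" for X Y
      using that unfolding carrier_W by (auto simp: add add_M_inf)
    ultimately show "?\<phi> \<in> iso (add_monoid (W (int m))) (add_monoid (M_inf m))"
      by (auto simp: iso_def hom_def bij_betw_def)
  next
    fix a X assume "X \<in> carrier (W (int m))"
    then show "?\<phi> (a \<odot>\<^bsub>W (int m)\<^esub> X) = a \<odot>\<^bsub>M_inf m\<^esub> ?\<phi> X"
      unfolding carrier_W by (auto simp: smult smult_M_inf)
  next
    fix g X assume "g \<in> carrier Sp_inf" "X \<in> carrier (W (int m))"
    then obtain N z where "g \<in> carrier (Sp N)" "z \<in> fock (int m)" "X = ?c z"
      unfolding carrier_W by (auto simp: Sp_inf_def)
    then show "?\<phi> (W_act (int m) g X) = M_act m g (?\<phi> X)"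
      by (simp only: W_act_class M_act_class)
  qed
qed

end
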